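(* Let $N,m,d,h$ be natural numbers with $d\geqslant h\geqslant m+2$, and let $c,C,\varepsilon$ be positive constants. Let $\Xi=\Xi(N):\mathbb{R}^h\to\mathbb{R}^d$ be an injective linear map with integer coefficients such that $\Xi(\mathbb{Z}^h)=\mathbb{Z}^d\cap\operatorname{im}\Xi$. Let $L=L(N):\mathbb{R}^h\to\mathbb{R}^m$ be a surjective linear map. Assume $\Vert\Xi\Vert_\infty\leqslant C$, $\Vert L\Vert_\infty\leqslant C$, $\operatorname{dist}(L,V_{\mathrm{rank}}(m,h))\geqslant c$ and $\operatorname{dist}((\Xi,L),V^*_{\mathrm{degen},2}(m,d,h))\geqslant c$. Then there exists a natural number $s\leqslant d-2$, independent of $\varepsilon$, such that the following holds. Let $0<\sigma_F,\sigma_G<1/2$. Let $F:\mathbb{R}^h\to[0,1]$ be a Lipschitz function supported on $[-N,N]^h$ with Lipschitz constant $O(1/(\sigma_FN))$, and $G:\mathbb{R}^m\to[0,1]$ a Lipschitz function supported on $[-\varepsilon,\varepsilon]^m$ with Lipschitz constant $O(1/\sigma_G)$. Let $\widetilde{\mathbf r}\in\mathbb{Z}^d$ with $\Vert\widetilde{\mathbf r}\Vert_\infty=O_{c,C,\varepsilon}(1)$. Suppose $f_1,\dots,f_d:[N]\to[-1,1]$ satisfy $\min_j\Vert f_j\Vert_{U^{s+1}[N]}\leqslant\rho$ for some $0<\rho\leqslant1$. Then $$T^{L,\Xi,\widetilde{\mathbf r}}_{F,G,N}(f_1,\dots,f_d)\ll_{c,C,\varepsilon}\rho^{\Omega(1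)}(\sigma_F^{-O(1)}+\sigma_G^{-O(1)})+\sigma_F^{-O(1)}N^{-\Omega(1)}.$$
   Context: Matrices identified with linear maps; $\Vert\cdot\Vert_\infty$ max absolute entry; $\operatorname{dist}$ is $\ell^\infty$ distance on entries. $V_{\mathrm{rank}}(m,h)$: $m\times h$ matrices of rank $<m$. Dual pair degeneracy variety $V^*_{\mathrm{degen},2}(m,d,h)$: pairs of linear maps $\Xi:\mathbb{R}^h\to\mathbb{R}^d$, $L:\mathbb{R}^h\to\mathbb{R}^m$ for which there exist $i,j\leqslant d$ and $\lambda\in\mathbb{R}$ with $\mathbf e_i^*-\lambda\mathbf e_j^*\neq0$ and $\Xi^*(\mathbf e_i^*-\lambda\mathbf e_j^* )\in L^*((\mathbb{R}^m)^* )$ (here $\mathbf e_i^*$ is the standard dual basis of $(\mathbb{R}^d)^*$, $\Xi^*\varphi=\varphi\circ\Xi$). $\operatorname{dist}((\Xi,L),V^*_{\mathrm{degen},2}(m,d,h))\geqslant c$ means $(\Xi+Q,L)\notin V^*_{\mathrm{degen},2}(m,d,h)$ for every linear $Q:\mathbb{R}^h\to\mathbb{R}^d$ with $\Vert Q\Vert_\infty<c$. For $F:\mathbb{R}^h\to[0,1]$ supported on $[-N,N]^h$, compactly supported $G:\mathbb{R}^m\to[0,1]$, $\widetilde{\mathbf r}\in\mathbb{Z}^d$ and $f_j$ extended by zero to $\mathbb{Z}$: $T^{L,\Xi,\widetilde{\mathbf r}}_{F,G,N}(f_1,\dots,f_d)=N^{-(h-m)}\sum_{\mathbf n\in\mathbb{Z}^h}\prod_{j=1}^d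 f_j(\xi_j(\mathbf n)+\widetilde r_j)F(\mathbf n)G(L\mathbf n)$, where $\xi_j$ is the $j$-th coordinate of $\Xi$. A function $F$ is Lipschitz with constant $M$ if $|F(\mathbf x)-F(\mathbf y)|\leqslant M\Vert\mathbf x-\mathbf y\Vert_\infty$. Gowers norm: $\Vert f\Vert_{U^k[N]}=\Vert f1_{[N]}\Vert_{U^k(N')}/\Vert1_{[N]}\Vert_{U^k(N')}$ with $\Vert g\Vert_{U^k(N')}^{2^k}=N'^{-(k+1)}\sum_{x,\mathbf h}\prod_{\boldsymbol\omega\in\{0,1\}^k}\mathcal C^{|\boldsymbol\omega|}g(x+\mathbf h\cdot\boldsymbol\omega)$ on $\mathbb{Z}/N'\mathbb{Z}$, $N'/N$ large in terms of $k$. Asymptotic notation: implied constants may depend on $m,d,h$ and on constants implicit in the hypotheses; $\rho^{\Omega(1)}$, $N^{-\Omega(1)}$ are powers with exponents bounded away from $0$ depending on dimensions; $\sigma^{-O(1)}$ is $\sigma^{-K}$ with $K$ depending on dimensions. *)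

theory Defs
  imports "HOL-Analysis.Analysis"
begin

text \<open>Matrices are elements of real^'h^'d etc. (rows indexed by the target
  index type), identified with linear maps via matrix-vector multiplication.\<close>

definition mat_maxnorm :: "real^'n^'k \<Rightarrow> real" where
  "mat_maxnorm M = Max {\<bar>M $ i $ j\<bar> | i j. True}"

definition vec_maxnorm :: "real^'n \<Rightarrow> real" where
  "vec_maxnorm x = Max {\<bar>x $ i\<bar> | i. True}"

definition int_to_real_mat :: "int^'n^'k \<Rightarrow> real^'n^'k" where
  "int_to_real_mat M = (\<chi> i j. real_of_int (M $ i $ j))"

definition int_to_real_vec :: "int^'n \<Rightarrow> real^'n" where
  "int_to_real_vec x = (\<chi> i. real_of_int (x $ i))"

definition V_rank :: "(real^'h^'m) set" where
  "V_rank = {M. rank M < CARD('m)}"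

definition dist_rank_ge :: "real^'h^'m \<Rightarrow> real \<Rightarrow> bool" where
  "dist_rank_ge L c \<longleftrightarrow> (\<forall>Q. mat_maxnorm Q < c \<longrightarrow> L + Q \<notin> V_rank)"

text \<open>Dual pair degeneracy variety V*_degen,2(m,d,h). Linear functionals on R^d
  (resp. R^m) are represented by coefficient vectors phi; the pullback
  Xi^* phi = phi o Xi has coefficient vector phi v* Xi.\<close>
definition V_degen2 :: "((real^'h^('d::finite)) \<times> (real^'h^'m)) set" where
  "V_degen2 = {(Xi, L). \<exists>(i::'d) (j::'d) (lam::real).
      (axis i 1 - lam *\<^sub>R axis j 1 :: real^'d) \<noteq> 0 \<and>
      (axis i 1 - lam *\<^sub>R axis j 1 :: real^'d) v* Xi
         \<in> range (\<lambda>psi::real^'m. psi v* L)}"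

definition dist_degen_ge :: "real^'h^'d \<Rightarrow> real^'h^'m \<Rightarrow> real \<Rightarrow> bool" where
  "dist_degen_ge Xi L c \<longleftrightarrow>
     (\<forall>Q::real^'h^'d. mat_maxnorm Q < c \<longrightarrow> (Xi + Q, L) \<notin> V_degen2)"

definition int_lattice :: "(real^'n) set" where
  "int_lattice = {x. \<forall>i. x $ i \<in> \<int>}"

text \<open>Gowers U^k norm on Z/N'Z of a real function g (read on residues 0..N'-1);
  conjugation is trivial for real-valued functions. omega in {0,1}^k is encoded
  as a subset S of {..<k}, and h . omega = sum_{i in S} h_i.\<close>
definition gowers_ZN :: "nat \<Rightarrow> nat \<Rightarrow> (int \<Rightarrow> real) \<Rightarrow> real" where
  "gowers_ZN N' k g = root (2 ^ k)
     ((1 / real N' ^ (k + 1)) *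
      (\<Sum>x\<in>{0..<int N'}. \<Sum>hh\<in>PiE {..<k} (\<lambda>_. {0..<int N'}).
          \<Prod>S\<in>Pow {..<k}. g ((x + (\<Sum>i\<in>S. hh i)) mod int N')))"

text \<open>The auxiliary modulus N' used for U^k[N]: N' = 2^(k+1) * N, which is large
  compared with N in terms of k (for k >= 1 no wrap-around occurs).\<close>
definition gowers_modulus :: "nat \<Rightarrow> nat \<Rightarrow> nat" where
  "gowers_modulus k N = 2 ^ (k + 1) * N"

definition gowers_interval :: "nat \<Rightarrow> nat \<Rightarrow> (int \<Rightarrow> real) \<Rightarrow> real" where
  "gowers_interval k N f =
     gowers_ZN (gowers_modulus k N) k (\<lambda>x. if x \<in> {1..int N} then f x else 0) /
     gowers_ZN (gowers_modulus k N) k (\<lambda>x. if x \<in> {1..int N} then 1 else 0)"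

text \<open>The counting operator T^{L,Xi,r}_{F,G,N}. Since F is supported on [-N,N]^h,
  the sum over Z^h is the (finite) sum over the lattice points of that box.\<close>
definition T_op :: "real^'h^'m \<Rightarrow> int^'h^'d \<Rightarrow> ('d \<Rightarrow> int) \<Rightarrow> (real^'h \<Rightarrow> real)
     \<Rightarrow> (real^'m \<Rightarrow> real) \<Rightarrow> nat \<Rightarrow> ('d \<Rightarrow> int \<Rightarrow> real) \<Rightarrow> real" where
  "T_op L Xi r F G N f =
     (1 / real N ^ (CARD('h) - CARD('m))) *
     (\<Sum>n\<in>{n::int^'h. \<forall>i. \<bar>n $ i\<bar> \<le> int N}.
        (\<Prod>j\<in>UNIV. f j ((Xi *v n) $ j + r j)) *
        F (int_to_real_vec n) * G (L *v int_to_real_vec n))"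

end

theory Submission
  imports Defs
begin

text \<open>One can take \<open>s = d - 2\<close>, and no passage to the reals is needed. Fix the index \<open>j0\<close> of a function with
  small norm. Nondegeneracy gives, for each \<open>j \<noteq> j0\<close>, a bounded real vector killed by \<open>L\<close> and by
  \<open>\<xi>\<^sub>j\<close> on which \<open>\<xi>\<^sub>j\<^sub>0\<close> is \<open>1\<close>; rounding its multiples and pigeonholing yields at least a power of \<open>\<delta>\<close>
  times \<open>N\<close> integer vectors \<open>w\<close> of size at most \<open>\<delta> N\<close> with \<open>\<xi>\<^sub>j w = 0\<close>, \<open>L w\<close> of size at most \<open>\<delta>\<close>, and
  distinct values \<open>\<xi>\<^sub>j\<^sub>0 w\<close>. Averaging the count over shifts by sums of such vectors, one for each \<open>j \<noteq> j0\<close>,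
  changes \<open>F\<close> and \<open>G\<close> by \<open>O(\<delta>/\<sigma>\<^sub>F + \<delta>/\<sigma>\<^sub>G)\<close>, and for each fixed \<open>n\<close> the average of the product of
  the \<open>f\<^sub>j\<close> is bounded by the \<open>U\<close>-norm of degree \<open>d - 1\<close> of \<open>f\<^sub>j\<^sub>0\<close> through \<open>d - 1\<close> applications of
  Cauchy-Schwarz. The choice is \<open>\<delta> = \<rho>\<^sup>a\<close> with \<open>a\<close> small; if \<open>\<rho>\<close> is so small in terms of \<open>N\<close> that \<open>\<delta> N\<close> is not
  large, the trivial shifts already suffice.\<close>

section \<open>Repeated Cauchy-Schwarz on product sets\<close>

lemma sum_PiE_insert:
  assumes "i \<notin> I"
  shows "(\<Sum>y\<in>PiE (insert i I) B. q y) = (\<Sum>z\<in>B i. \<Sum>y\<in>PiE I B. q (y(i := z)))"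
proof -
  have "(\<Sum>y\<in>PiE (insert i I) B. q y) = (\<Sum>(z, y)\<in>B i \<times> PiE I B. q (y(i := z)))"
    unfolding PiE_insert_eq using inj_combinator[OF assms, of B]
    by (subst sum.reindex) (auto simp: case_prod_unfold)
  then show ?thesis by (simp add: sum.cartesian_product)
qed

text \<open>Iterated Cauchy-Schwarz: the case \<open>k\<close>, applied to the squares, gives the
  case \<open>Suc k\<close>. The factor \<open>card A\<close> on the left avoids both a division and
  the exponent \<open>2 ^ k - 1\<close>.\<close>

lemma sum_power_two_le:
  fixes x :: "'a \<Rightarrow> real"
  shows "real (card A) * (\<Sum>a\<in>A. x a) ^ (2 ^ k) \<le> real (card A) ^ (2 ^ k) * (\<Sum>a\<in>A. x a ^ (2 ^ k))"
proof (induction k arbitrary: x)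
  case (Suc k)
  have "real (card A) * (\<Sum>a\<in>A. x a) ^ (2 ^ Suc k) = real (card A) * ((\<Sum>a\<in>A. x a)\<^sup>2) ^ (2 ^ k)"
    by (simp add: power_mult)
  also have "\<dots> \<le> real (card A) * (real (card A) * (\<Sum>a\<in>A. (x a)\<^sup>2)) ^ (2 ^ k)"
    using sum_squared_le_sum_of_squares[of x A]
    by (intro mult_left_mono power_mono) (auto simp: mult.commute)
  also have "\<dots> = real (card A) ^ (2 ^ k) * (real (card A) * (\<Sum>a\<in>A. (x a)\<^sup>2) ^ (2 ^ k))"
    by (simp add: power_mult_distrib)
  also have "\<dots> \<le> real (card A) ^ (2 ^ k) * (real (card A) ^ (2 ^ k) * (\<Sum>a\<in>A. ((x a)\<^sup>2) ^ (2 ^ k)))"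
    by (intro mult_left_mono Suc) auto
  also have "\<dots> = real (card A) ^ (2 ^ Suc k) * (\<Sum>a\<in>A. x a ^ (2 ^ Suc k))"
    by (simp add: mult_2 power_add power_mult[symmetric] mult.assoc)
  finally show ?case .
qed simp

text \<open>A vertex of the combinatorial cube with opposite corners \<open>y0\<close> and
  \<open>y1\<close>; the product over all vertices, \<open>S\<close> in \<open>Pow {..<k}\<close>,
  is the integrand of the Gowers box norm.\<close>

definition mix :: "nat set \<Rightarrow> (nat \<Rightarrow> 'a) \<Rightarrow> (nat \<Rightarrow> 'a) \<Rightarrow> nat \<Rightarrow> 'a" where
  "mix S y0 y1 = (\<lambda>i. if i \<in> S then y1 i else y0 i)"

lemma prod_Pow_lessThan_Suc:
  "(\<Prod>S\<in>Pow {..<Suc k}. p S) = (\<Prod>S\<in>Pow {..<k}. p S * p (insert k S))"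
proof -
  have inj: "inj_on (insert k) (Pow {..<k})"
    by (auto simp: inj_on_def)
  show ?thesis
    unfolding lessThan_Suc Pow_insert
    by (subst prod.union_disjoint) (auto simp: prod.reindex[OF inj] prod.distrib)
qed

text \<open>The Gowers-Cauchy-Schwarz bound, unnormalised: each weight \<open>b i\<close> ignores
  coordinate \<open>i\<close>, so one Cauchy-Schwarz step removes it and doubles that coordinate.
  Powers of \<open>card Y\<close> stand in for averages, so no division occurs.\<close>

lemma box_cauchy_schwarz:
  fixes \<Phi> :: "(nat \<Rightarrow> 'a) \<Rightarrow> real" and b :: "nat \<Rightarrow> (nat \<Rightarrow> 'a) \<Rightarrow> real"
  assumes "\<And>i y. i < k \<Longrightarrow> \<bar>b i y\<bar> \<le> 1" "\<And>i y z. i < k \<Longrightarrow> b i (y(i := z)) = b i y"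
  shows "real (card Y) ^ (2 * k) * (\<Sum>y\<in>PiE {..<k} (\<lambda>_. Y). \<Phi> y * (\<Prod>i<k. b i y)) ^ (2 ^ k)
    \<le> real (card Y) ^ (k * 2 ^ k) * (\<Sum>y0\<in>PiE {..<k} (\<lambda>_. Y). \<Sum>y1\<in>PiE {..<k} (\<lambda>_. Y).
        \<Prod>S\<in>Pow {..<k}. \<Phi> (mix S y0 y1))"
  using assms
proof (induction k arbitrary: \<Phi> b)
  case 0
  show ?case by (simp add: mix_def)
next
  case (Suc k)
  define P where "P = PiE {..<k} (\<lambda>_. Y)"
  define M where "M = real (card Y)"
  \<comment> \<open>For fixed values \<open>z0\<close>, \<open>z1\<close> of the doubled last
    coordinate this is again a sum of the same shape in \<open>k\<close> coordinates:
    \<open>\<Phi>\<close> and each \<open>b i\<close> become products of their two slices.\<close>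
  define Z where "Z z0 z1 = (\<Sum>y\<in>P. (\<Phi> (y(k := z0)) * \<Phi> (y(k := z1))) *
      (\<Prod>i<k. b i (y(k := z0)) * b i (y(k := z1))))" for z0 z1
  define X where "X z0 z1 = (\<Sum>y0\<in>P. \<Sum>y1\<in>P.
      \<Prod>S\<in>Pow {..<k}. \<Phi> ((mix S y0 y1)(k := z0)) * \<Phi> ((mix S y0 y1)(k := z1)))" for z0 z1
  have M0: "0 \<le> M" by (simp add: M_def)
  have cardP: "real (card P) = M ^ k" by (simp add: P_def M_def card_PiE)
  have IH: "M ^ (2 * k) * Z z0 z1 ^ (2 ^ k) \<le> M ^ (k * 2 ^ k) * X z0 z1" for z0 z1
    unfolding M_def Z_def X_def P_def
  proof (rule Suc.IH)
    fix i y assume "i < k"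
    then show "\<bar>b i (y(k := z0)) * b i (y(k := z1))\<bar> \<le> 1"
      using Suc.prems(1)[of i] by (auto simp: abs_mult intro!: mult_le_one)
  next
    fix i and y :: "nat \<Rightarrow> 'a" and z assume i: "i < k"
    then have "(y(i := z))(k := u) = (y(k := u))(i := z)" for u
      by (auto simp: fun_upd_twist)
    then show "b i ((y(i := z))(k := z0)) * b i ((y(i := z))(k := z1)) =
        b i (y(k := z0)) * b i (y(k := z1))"
      using Suc.prems(2)[of i] i by (simp del: fun_upd_apply)
  qed
  \<comment> \<open>The sum over the last coordinate alone. The weight \<open>b k\<close> does not
    see that coordinate, so it comes out and is discarded by Cauchy-Schwarz.\<close>
  define A where "A y = (\<Sum>z\<in>Y. \<Phi> (y(k := z)) * (\<Prod>i<k. b i (y(k := z))))" for y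
  have bk: "b k (y(k := z)) = b k y" for y z by (rule Suc.prems(2)) simp
  have split: "(\<Sum>y\<in>PiE {..<Suc k} (\<lambda>_. Y). \<Phi> y * (\<Prod>i<Suc k. b i y)) = (\<Sum>y\<in>P. b k y * A y)"
    unfolding lessThan_Suc A_def
    by (subst sum_PiE_insert)
      (auto simp: bk sum_distrib_left mult_ac sum.swap[of _ Y] P_def intro!: sum.cong)
  have "(\<Sum>y\<in>P. b k y * A y)\<^sup>2 \<le> (\<Sum>y\<in>P. (b k y)\<^sup>2) * (\<Sum>y\<in>P. (A y)\<^sup>2)"
    by (rule Cauchy_Schwarz_ineq_sum)
  also have "\<dots> \<le> real (card P) * (\<Sum>y\<in>P. (A y)\<^sup>2)"
  proof (intro mult_right_mono sum_nonneg)
    have "(\<Sum>y\<in>P. (b k y)\<^sup>2) \<le> (\<Sum>y\<in>P. 1)"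
      using Suc.prems(1)[of k] by (intro sum_mono) (simp add: abs_square_le_1)
    then show "(\<Sum>y\<in>P. (b k y)\<^sup>2) \<le> real (card P)" by simp
  qed auto
  also have "(\<Sum>y\<in>P. (A y)\<^sup>2) = (\<Sum>z0\<in>Y. \<Sum>z1\<in>Y. Z z0 z1)"
    unfolding A_def Z_def power2_eq_square sum_product
    by (subst sum.swap, rule sum.cong[OF refl], subst sum.swap)
      (auto simp: prod.distrib mult_ac intro!: sum.cong)
  finally have CS: "(\<Sum>y\<in>P. b k y * A y)\<^sup>2 \<le> M ^ k * (\<Sum>z0\<in>Y. \<Sum>z1\<in>Y. Z z0 z1)"
    by (simp add: cardP)
  have pm: "M\<^sup>2 * (\<Sum>z0\<in>Y. \<Sum>z1\<in>Y. Z z0 z1) ^ (2 ^ k)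
      \<le> M ^ (2 * 2 ^ k) * (\<Sum>z0\<in>Y. \<Sum>z1\<in>Y. Z z0 z1 ^ (2 ^ k))"
    using sum_power_two_le[of "Y \<times> Y" "\<lambda>(z0, z1). Z z0 z1" k]
    by (simp add: sum.cartesian_product card_cartesian_product M_def
        power2_eq_square power_mult case_prod_unfold)
  have "M ^ (2 * Suc k) * (\<Sum>y\<in>P. b k y * A y) ^ (2 ^ Suc k)
      = M ^ (2 * Suc k) * ((\<Sum>y\<in>P. b k y * A y)\<^sup>2) ^ (2 ^ k)"
    by (simp add: power_mult)
  also have "\<dots> \<le> M ^ (2 * Suc k) * (M ^ k * (\<Sum>z0\<in>Y. \<Sum>z1\<in>Y. Z z0 z1)) ^ (2 ^ k)"
    using CS M0 by (intro mult_left_mono power_mono) auto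
  also have "\<dots> = M ^ (2 * k) * M ^ (k * 2 ^ k) * (M\<^sup>2 * (\<Sum>z0\<in>Y. \<Sum>z1\<in>Y. Z z0 z1) ^ (2 ^ k))"
    by (simp add: power_mult_distrib power_mult[symmetric] power_add[symmetric] power2_eq_square)
  also have "\<dots> \<le> M ^ (2 * k) * M ^ (k * 2 ^ k) *
      (M ^ (2 * 2 ^ k) * (\<Sum>z0\<in>Y. \<Sum>z1\<in>Y. Z z0 z1 ^ (2 ^ k)))"
    using M0 by (intro mult_left_mono pm) auto
  also have "\<dots> = M ^ (k * 2 ^ k) * M ^ (2 * 2 ^ k) *
      (\<Sum>z0\<in>Y. \<Sum>z1\<in>Y. M ^ (2 * k) * Z z0 z1 ^ (2 ^ k))"
    by (simp add: sum_distrib_left mult_ac)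
  also have "\<dots> \<le> M ^ (k * 2 ^ k) * M ^ (2 * 2 ^ k) *
      (\<Sum>z0\<in>Y. \<Sum>z1\<in>Y. M ^ (k * 2 ^ k) * X z0 z1)"
    using M0 by (intro mult_left_mono sum_mono IH) auto
  also have "\<dots> = M ^ (Suc k * 2 ^ Suc k) * (\<Sum>z0\<in>Y. \<Sum>z1\<in>Y. X z0 z1)"
    by (simp add: sum_distrib_left[symmetric] mult.assoc[symmetric] power_add[symmetric])
      (simp add: algebra_simps)
  also have "(\<Sum>z0\<in>Y. \<Sum>z1\<in>Y. X z0 z1) =
      (\<Sum>y0\<in>PiE {..<Suc k} (\<lambda>_. Y). \<Sum>y1\<in>PiE {..<Suc k} (\<lambda>_. Y).
        \<Prod>S\<in>Pow {..<Suc k}. \<Phi> (mix S y0 y1))"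
  proof -
    \<comment> \<open>A subset of \<open>{..<Suc k}\<close> omits or contains \<open>k\<close>;
      these are the two facets of the cube, where the last coordinate is \<open>z0\<close> or
      \<open>z1\<close>.\<close>
    have m: "mix S (y0(k := z0)) (y1(k := z1)) = (mix S y0 y1)(k := z0)"
      "mix (insert k S) (y0(k := z0)) (y1(k := z1)) = (mix S y0 y1)(k := z1)"
      if "S \<in> Pow {..<k}" for S y0 z0 y1 z1
      using that by (auto simp: mix_def fun_eq_iff)
    have "(\<Sum>y0\<in>PiE {..<Suc k} (\<lambda>_. Y). \<Sum>y1\<in>PiE {..<Suc k} (\<lambda>_. Y).
        \<Prod>S\<in>Pow {..<Suc k}. \<Phi> (mix S y0 y1)) =
      (\<Sum>z0\<in>Y. \<Sum>y0\<in>P. \<Sum>z1\<in>Y. \<Sum>y1\<in>P.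
        \<Prod>S\<in>Pow {..<k}. \<Phi> ((mix S y0 y1)(k := z0)) * \<Phi> ((mix S y0 y1)(k := z1)))"
      unfolding prod_Pow_lessThan_Suc unfolding lessThan_Suc
      by (simp add: sum_PiE_insert P_def m)
    also have "\<dots> = (\<Sum>z0\<in>Y. \<Sum>z1\<in>Y. X z0 z1)"
      unfolding X_def by (intro sum.cong refl sum.swap)
    finally show ?thesis ..
  qed
  finally show ?case unfolding split M_def by simp
qed

section \<open>Gowers sums on a cyclic group\<close>

definition gowers_sum :: "nat \<Rightarrow> nat \<Rightarrow> (int \<Rightarrow> real) \<Rightarrow> real" where
  "gowers_sum M k g = (\<Sum>x\<in>{0..<int M}. \<Sum>hh\<in>PiE {..<k} (\<lambda>_. {0..<int M}).
          \<Prod>S\<in>Pow {..<k}. g ((x + (\<Sum>i\<in>S. hh i)) mod int M))"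

lemma sum_shift_mod:
  fixes M :: nat and H :: "int \<Rightarrow> 'b::comm_monoid_add"
  assumes "M > 0"
  shows "(\<Sum>z\<in>{0..<int M}. H ((a + z) mod int M)) = (\<Sum>z\<in>{0..<int M}. H z)"
  using assms
  by (intro sum.reindex_bij_witness[of _ "\<lambda>z. (z - a) mod int M" "\<lambda>z. (a + z) mod int M"])
    (auto simp: mod_simps)

text \<open>The substitution \<open>hh i = y1 i - y0 i\<close> modulo \<open>M\<close> turns the box
  into a cube with base point \<open>a + (\<Sum>i<k. y0 i)\<close>. As one coordinate of
  \<open>y0\<close> sweeps all residues, the base point takes each residue
  \<open>M ^ (k - 1)\<close> times.\<close>

lemma box_sum_eq_gowers_sum:
  fixes M k :: nat
  assumes M: "M > 0" and k: "k \<ge> 1"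
  defines "Y \<equiv> {0..<int M}"
  shows "(\<Sum>y0\<in>PiE {..<k} (\<lambda>_. Y). \<Sum>y1\<in>PiE {..<k} (\<lambda>_. Y).
        \<Prod>S\<in>Pow {..<k}. g ((a + (\<Sum>i<k. mix S y0 y1 i)) mod int M)) = real M ^ (k - 1) * gowers_sum M k g"
proof -
  define H where "H x = (\<Sum>hh\<in>PiE {..<k} (\<lambda>_. Y).
     \<Prod>S\<in>Pow {..<k}. g ((x + (\<Sum>i\<in>S. hh i)) mod int M))" for x
  have Hmod: "H (x mod int M) = H x" for x
    unfolding H_def by (simp add: mod_simps)
  have "(\<Sum>y1\<in>PiE {..<k} (\<lambda>_. Y).
        \<Prod>S\<in>Pow {..<k}. g ((a + (\<Sum>i<k. mix S y0 y1 i)) mod int M)) = H (a + (\<Sum>i<k. y0 i))" for y0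
    unfolding H_def
  proof (rule sum.reindex_bij_witness[of _ "\<lambda>hh. \<lambda>i\<in>{..<k}. (hh i + y0 i) mod int M"
        "\<lambda>y1. \<lambda>i\<in>{..<k}. (y1 i - y0 i) mod int M"])
    fix y1 assume y1: "y1 \<in> PiE {..<k} (\<lambda>_. Y)"
    show "(\<lambda>i\<in>{..<k}. ((\<lambda>i\<in>{..<k}. (y1 i - y0 i) mod int M) i + y0 i) mod int M) = y1"
      using y1 by (auto simp: fun_eq_iff PiE_def Pi_def extensional_def Y_def mod_simps)
    show "(\<lambda>i\<in>{..<k}. (y1 i - y0 i) mod int M) \<in> PiE {..<k} (\<lambda>_. Y)"
      using M by (auto simp: Y_def)
    show "(\<Prod>S\<in>Pow {..<k}. g ((a + (\<Sum>i<k. y0 i) + (\<Sum>i\<in>S. (\<lambda>i\<in>{..<k}. (y1 i - y0 i) mod int M) i)) mod int M))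
      = (\<Prod>S\<in>Pow {..<k}. g ((a + (\<Sum>i<k. mix S y0 y1 i)) mod int M))"
    proof (rule prod.cong[OF refl])
      fix S assume S: "S \<in> Pow {..<k}"
      have "(\<Sum>i<k. mix S y0 y1 i) = (\<Sum>i<k. y0 i + (if i \<in> S then y1 i - y0 i else 0))"
        by (intro sum.cong) (auto simp: mix_def)
      also have "\<dots> = (\<Sum>i<k. y0 i) + (\<Sum>i\<in>S. y1 i - y0 i)"
        using S by (simp add: sum.distrib sum.inter_restrict[symmetric] Int_absorb1)
      finally have e: "(\<Sum>i<k. mix S y0 y1 i) = (\<Sum>i<k. y0 i) + (\<Sum>i\<in>S. y1 i - y0 i)" .
      have "(\<Sum>i\<in>S. (\<lambda>i\<in>{..<k}. (y1 i - y0 i) mod int M) i) = (\<Sum>i\<in>S. (y1 i - y0 i) mod int M)"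
        using S by (intro sum.cong) auto
      then have "(\<Sum>i\<in>S. (\<lambda>i\<in>{..<k}. (y1 i - y0 i) mod int M) i) mod int M = (\<Sum>i\<in>S. y1 i - y0 i) mod int M"
        by (simp add: mod_sum_eq)
      then have "(a + (\<Sum>i<k. y0 i) + (\<Sum>i\<in>S. (\<lambda>i\<in>{..<k}. (y1 i - y0 i) mod int M) i)) mod int M
         = (a + (\<Sum>i<k. mix S y0 y1 i)) mod int M"
        unfolding e add.assoc[symmetric] by (metis mod_add_right_eq)
      then show "g ((a + (\<Sum>i<k. y0 i) + (\<Sum>i\<in>S. (\<lambda>i\<in>{..<k}. (y1 i - y0 i) mod int M) i)) mod int M)
         = g ((a + (\<Sum>i<k. mix S y0 y1 i)) mod int M)" by simp
    qed
  next
    fix hh assume hh: "hh \<in> PiE {..<k} (\<lambda>_. Y)"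
    show "(\<lambda>i\<in>{..<k}. ((\<lambda>i\<in>{..<k}. (hh i + y0 i) mod int M) i - y0 i) mod int M) = hh"
      using hh by (auto simp: fun_eq_iff PiE_def Pi_def extensional_def Y_def mod_simps)
    show "(\<lambda>i\<in>{..<k}. (hh i + y0 i) mod int M) \<in> PiE {..<k} (\<lambda>_. Y)"
      using M by (auto simp: Y_def)
  qed
  then have "(\<Sum>y0\<in>PiE {..<k} (\<lambda>_. Y). \<Sum>y1\<in>PiE {..<k} (\<lambda>_. Y).
        \<Prod>S\<in>Pow {..<k}. g ((a + (\<Sum>i<k. mix S y0 y1 i)) mod int M))
      = (\<Sum>y0\<in>PiE {..<k} (\<lambda>_. Y). H (a + (\<Sum>i<k. y0 i)))" by simp
  also have "\<dots> = real M ^ (k - 1) * (\<Sum>x\<in>Y. H x)"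
  proof -
    obtain k' where k': "k = Suc k'" using k by (cases k) auto
    have "(\<Sum>y0\<in>PiE {..<k} (\<lambda>_. Y). H (a + (\<Sum>i<k. y0 i)))
       = (\<Sum>y\<in>PiE {..<k'} (\<lambda>_. Y). \<Sum>z\<in>Y. H (a + (z + (\<Sum>i<k'. y i))))"
      unfolding k' lessThan_Suc by (subst sum_PiE_insert) (auto simp: sum.swap[of _ Y] intro!: sum.cong)
    also have "\<dots> = (\<Sum>y\<in>PiE {..<k'} (\<lambda>_. Y). \<Sum>z\<in>Y. H (((a + (\<Sum>i<k'. y i)) + z) mod int M))"
      by (simp add: Hmod algebra_simps)
    also have "\<dots> = (\<Sum>y\<in>PiE {..<k'} (\<lambda>_. Y). \<Sum>z\<in>Y. H z)"
      unfolding Y_def by (simp add: sum_shift_mod[OF M])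
    finally show ?thesis by (simp add: k' card_PiE Y_def)
  qed
  finally show ?thesis by (simp add: H_def gowers_sum_def Y_def)
qed

lemma gowers_ZN_altdef: "gowers_ZN M k g = root (2 ^ k) (1 / real M ^ (k + 1) * gowers_sum M k g)"
  by (simp add: gowers_ZN_def gowers_sum_def)

text \<open>For a function of \<open>a + (\<Sum>i<k. y i)\<close> the box norm is the Gowers norm,
  so \<open>box_cauchy_schwarz\<close> removes all weights that ignore one coordinate.\<close>

lemma weighted_sum_le_gowers:
  fixes M k :: nat and g :: "int \<Rightarrow> real" and b :: "nat \<Rightarrow> (nat \<Rightarrow> int) \<Rightarrow> real"
  assumes M: "M > 0" and k: "k \<ge> 1"
    and b: "\<And>i y. i < k \<Longrightarrow> \<bar>b i y\<bar> \<le> 1" "\<And>i y z. i < k \<Longrightarrow> b i (y(i := z)) = b i y"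
    and \<rho>: "gowers_ZN M k g \<le> \<rho>" "0 \<le> \<rho>"
  shows "\<bar>\<Sum>y\<in>PiE {..<k} (\<lambda>_. {0..<int M}). g ((a + (\<Sum>i<k. y i)) mod int M) * (\<Prod>i<k. b i y)\<bar>
     \<le> real M ^ k * \<rho>" (is "\<bar>?s\<bar> \<le> _")
proof -
  define G where "G = gowers_sum M k g"
  have ev: "even (2 ^ k :: nat)" using k by simp
  \<comment> \<open>Splitting on the sign stands in for a proof that the Gowers sum is nonnegative:
    a nonnegative value is recovered from its root, and a negative one is below the bound since
    \<open>0 \<le> \<rho>\<close>.\<close>
  have Gr: "1 / real M ^ (k + 1) * G \<le> \<rho> ^ (2 ^ k)"
  proof (cases "1 / real M ^ (k + 1) * G \<ge> 0")
    case True
    have "1 / real M ^ (k + 1) * G = gowers_ZN M k g ^ (2 ^ k)"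
      unfolding gowers_ZN_altdef G_def[symmetric] using True by (simp add: real_root_pow_pos2)
    also have "\<dots> \<le> \<rho> ^ (2 ^ k)"
      using \<rho> True by (intro power_mono) (auto simp: gowers_ZN_altdef G_def[symmetric])
    finally show ?thesis .
  next
    case False
    then show ?thesis using \<rho>(2) by (meson dual_order.trans linear zero_le_power)
  qed
  have "real M ^ (2 * k) * ?s ^ (2 ^ k) \<le> real M ^ (k * 2 ^ k) * (real M ^ (k - 1) * G)"
    using box_cauchy_schwarz[where k = k and b = b and Y = "{0..<int M}"
        and \<Phi> = "\<lambda>y. g ((a + (\<Sum>i<k. y i)) mod int M)", OF b]
    by (simp add: box_sum_eq_gowers_sum[OF M k] G_def)
  \<comment> \<open>The exponent \<open>k - 1\<close> from the box and \<open>k + 1\<close> from the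
    normalisation add up to \<open>2 * k\<close>, which cancels the factor on the left.\<close>
  also have "real M ^ (k - 1) * G = real M ^ (2 * k) * (1 / real M ^ (k + 1) * G)"
  proof -
    have "2 * k = (k - 1) + (k + 1)" using k by simp
    then have "real M ^ (2 * k) = real M ^ (k - 1) * real M ^ (k + 1)"
      by (metis power_add)
    then show ?thesis using M by simp
  qed
  finally have "real M ^ (2 * k) * ?s ^ (2 ^ k)
      \<le> real M ^ (2 * k) * (real M ^ (k * 2 ^ k) * (1 / real M ^ (k + 1) * G))"
    by (simp add: mult_ac)
  then have "?s ^ (2 ^ k) \<le> real M ^ (k * 2 ^ k) * (1 / real M ^ (k + 1) * G)"
    by (rule mult_left_le_imp_le) (use M in simp)
  also have "\<dots> \<le> real M ^ (k * 2 ^ k) * \<rho> ^ (2 ^ k)"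
    by (intro mult_left_mono Gr) auto
  finally have "\<bar>?s\<bar> ^ (2 ^ k) \<le> (real M ^ k * \<rho>) ^ (2 ^ k)"
    by (simp add: power_even_abs[OF ev] power_mult_distrib power_mult)
  \<comment> \<open>\<open>power_le_imp_le_base\<close> speaks of exponents \<open>Suc n\<close>,
    hence the instance \<open>2 ^ k - 1\<close>.\<close>
  then show ?thesis
    by (rule power_le_imp_le_base[of _ "2 ^ k - 1", simplified]) (use \<rho> in auto)
qed

text \<open>The normalising factor, the norm of the indicator of \<open>{1..int N}\<close>, lies
  between \<open>0\<close> (excluded) and \<open>1\<close>, so multiplying a nonnegative bound by it
  does not increase the bound.\<close>

lemma gowers_ZN_le_of_interval:
  assumes "N > 0" "gowers_interval k N f \<le> \<rho>" "0 \<le> \<rho>"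
  shows "gowers_ZN (gowers_modulus k N) k (\<lambda>x. if x \<in> {1..int N} then f x else 0) \<le> \<rho>"
proof -
  define M where "M = gowers_modulus k N"
  define e where "e = (\<lambda>x. if x \<in> {1..int N} then 1 else 0 :: real)"
  define D where "D = gowers_ZN M k e"
  have NM: "int N < int M" unfolding M_def gowers_modulus_def
    using assms(1) one_less_power[of "2::nat" "k + 1"] by (simp del: power_Suc)
  have M: "M > 0" using NM by simp
  have nn: "(\<Prod>S\<in>Pow {..<k}. e ((x + (\<Sum>i\<in>S. hh i)) mod int M)) \<ge> 0" for x hh
    by (intro prod_nonneg) (auto simp: e_def)
  have le: "(\<Prod>S\<in>Pow {..<k}. e ((x + (\<Sum>i\<in>S. hh i)) mod int M)) \<le> 1" for x hh
    by (intro prod_le_1) (auto simp: e_def)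
  have "gowers_sum M k e \<le> (\<Sum>x\<in>{0..<int M}. \<Sum>hh\<in>PiE {..<k} (\<lambda>_. {0..<int M}). 1)"
    unfolding gowers_sum_def by (intro sum_mono le)
  also have "\<dots> = real M ^ (k + 1)" by (simp add: card_PiE)
  finally have "1 / real M ^ (k + 1) * gowers_sum M k e \<le> 1"
    using M by (simp add: divide_simps)
  then have D1: "D \<le> 1"
    unfolding D_def gowers_ZN_altdef by simp
  \<comment> \<open>Positivity comes from one term: with \<open>x = 1\<close> and all differences
    zero, every vertex is \<open>1\<close>, which lies in \<open>{1..int N}\<close>.\<close>
  have "0 < (\<Prod>S\<in>Pow {..<k}. e ((1 + (\<Sum>i\<in>S. (\<lambda>i\<in>{..<k}. 0) i)) mod int M))"
  proof (rule prod_pos)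
    fix S assume "S \<in> Pow {..<k}"
    then have "(\<Sum>i\<in>S. (\<lambda>i\<in>{..<k}. 0::int) i) = 0" by (intro sum.neutral) auto
    then show "0 < e ((1 + (\<Sum>i\<in>S. (\<lambda>i\<in>{..<k}. 0) i)) mod int M)"
      using NM assms(1) by (simp add: e_def)
  qed
  also have "\<dots> \<le> (\<Sum>hh\<in>PiE {..<k} (\<lambda>_. {0..<int M}). \<Prod>S\<in>Pow {..<k}. e ((1 + (\<Sum>i\<in>S. hh i)) mod int M))"
    using M by (intro member_le_sum nn finite_PiE) (auto simp: PiE_iff extensional_def)
  also have "\<dots> \<le> gowers_sum M k e" unfolding gowers_sum_def
    using M NM assms(1) by (intro member_le_sum[of "1::int"] sum_nonneg nn) auto
  finally have "D > 0" unfolding D_def gowers_ZN_altdef using M by simp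
  moreover have "gowers_ZN M k (\<lambda>x. if x \<in> {1..int N} then f x else 0) / D \<le> \<rho>"
    using assms(2) by (simp add: gowers_interval_def D_def M_def e_def)
  ultimately have "gowers_ZN M k (\<lambda>x. if x \<in> {1..int N} then f x else 0) \<le> \<rho> * D"
    by (simp add: divide_simps)
  also have "\<dots> \<le> \<rho>" using D1 assms(3) by (simp add: mult_left_le)
  finally show ?thesis by (simp add: M_def)
qed

section \<open>Dual vectors, entrywise norms and rounding\<close>

text \<open>The component \<open>z\<close> of \<open>x\<close> orthogonal to \<open>span S\<close>
  has norm at least \<open>c\<close>; dividing \<open>z\<close> by the square of its norm gives the
  vector.\<close>

lemma exists_dual_vector:
  fixes x :: "'a::euclidean_space"
  assumes "\<And>s. s \<in> span S \<Longrightarrow> c \<le> norm (x - s)" "c > 0"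
  obtains v where "\<And>s. s \<in> S \<Longrightarrow> s \<bullet> v = 0" "x \<bullet> v = 1" "norm v \<le> 1 / c"
proof -
  obtain y z where y: "y \<in> span S" and z: "\<And>w. w \<in> span S \<Longrightarrow> orthogonal z w" and x: "x = y + z"
    using orthogonal_subspace_decomp_exists[of S x] by metis
  have nz: "c \<le> norm z" using assms(1)[OF y] x by simp
  then have z0: "z \<noteq> 0" using assms(2) by auto
  show thesis
  proof
    show "s \<bullet> (z /\<^sub>R (norm z)\<^sup>2) = 0" if "s \<in> S" for s
      using z[OF span_base[OF that]] by (simp add: orthogonal_def inner_commute)
    show "x \<bullet> (z /\<^sub>R (norm z)\<^sup>2) = 1"
      using z[OF y] z0 by (simp add: x inner_add_left orthogonal_def inner_commute[of y] dot_square_norm)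
    show "norm (z /\<^sub>R (norm z)\<^sup>2) \<le> 1 / c"
      using nz z0 assms(2) by (simp add: power2_eq_square divide_simps)
  qed
qed

lemma matrix_component_le_maxnorm: "\<bar>M $ i $ j\<bar> \<le> mat_maxnorm M"
proof -
  have "{\<bar>M $ i $ j\<bar> | i j. True} = (\<lambda>(i, j). \<bar>M $ i $ j\<bar>) ` UNIV" by auto
  then have "finite {\<bar>M $ i $ j\<bar> | i j. True}" by simp
  then show ?thesis unfolding mat_maxnorm_def by (rule Max_ge) blast
qed

lemma mat_maxnorm_less:
  assumes "\<And>i j. \<bar>M $ i $ j\<bar> < c"
  shows "mat_maxnorm M < c"
proof -
  have "{\<bar>M $ i $ j\<bar> | i j. True} = (\<lambda>(i, j). \<bar>M $ i $ j\<bar>) ` UNIV" by auto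
  then show ?thesis using assms unfolding mat_maxnorm_def by (subst Max_less_iff) auto
qed

lemma vec_maxnorm_le:
  assumes "\<And>i. \<bar>x $ i\<bar> \<le> c"
  shows "vec_maxnorm x \<le> c"
proof -
  have "{\<bar>x $ i\<bar> | i. True} = (\<lambda>i. \<bar>x $ i\<bar>) ` UNIV" by auto
  then show ?thesis using assms unfolding vec_maxnorm_def by (subst Max_le_iff) auto
qed

lemma vec_maxnorm_nonneg: "0 \<le> vec_maxnorm x"
proof -
  have "{\<bar>x $ i\<bar> | i. True} = (\<lambda>i. \<bar>x $ i\<bar>) ` UNIV" by auto
  then show ?thesis unfolding vec_maxnorm_def by (subst Max_ge_iff) auto
qed

lemma abs_matrix_vector_component_le:
  fixes A :: "real^'n^'k" and C :: real
  assumes "mat_maxnorm A \<le> C" "\<And>i. \<bar>x $ i\<bar> \<le> (R :: real)"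
  shows "\<bar>(A *v x) $ l\<bar> \<le> real CARD('n) * C * R"
proof -
  have "\<bar>(A *v x) $ l\<bar> \<le> (\<Sum>i\<in>UNIV. \<bar>A $ l $ i * x $ i\<bar>)"
    unfolding matrix_vector_mult_def by (simp add: sum_abs)
  also have "\<dots> \<le> (\<Sum>i\<in>(UNIV :: 'n set). C * R)"
  proof (rule sum_mono)
    fix i
    have "\<bar>A $ l $ i\<bar> \<le> C" using matrix_component_le_maxnorm[of A l i] assms(1) by linarith
    then show "\<bar>A $ l $ i * x $ i\<bar> \<le> C * R"
      using assms(2)[of i] by (simp add: abs_mult mult_mono')
  qed
  finally show ?thesis by simp
qed

lemma int_to_real_mat_mult:
  "(int_to_real_mat A *v int_to_real_vec n) $ j = of_int ((A *v n) $ j)"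
  by (simp add: matrix_vector_mult_def int_to_real_mat_def int_to_real_vec_def)

lemma int_to_real_vec_add: "int_to_real_vec (x + y) = int_to_real_vec x + int_to_real_vec y"
  by (simp add: int_to_real_vec_def vec_eq_iff)

lemma int_to_real_vec_diff: "int_to_real_vec (x - y) = int_to_real_vec x - int_to_real_vec y"
  by (simp add: int_to_real_vec_def vec_eq_iff)

lemma int_to_real_vec_sum: "int_to_real_vec (\<Sum>i\<in>I. w i) = (\<Sum>i\<in>I. int_to_real_vec (w i))"
  by (simp add: int_to_real_vec_def vec_eq_iff)

lemma int_to_real_vec_nth [simp]: "int_to_real_vec x $ i = of_int (x $ i)"
  by (simp add: int_to_real_vec_def)

definition round_vec :: "real^'n \<Rightarrow> int^'n" where
  "round_vec x = (\<chi> i. round (x $ i))"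

lemma abs_round_vec_diff_le: "\<bar>(int_to_real_vec (round_vec x) - x) $ i\<bar> \<le> 1 / 2"
  using of_int_round_abs_le[of "x $ i"] by (simp add: round_vec_def)

lemma abs_matrix_mult_round_vec_le:
  fixes A :: "real^'n^'k" and C :: real
  assumes "mat_maxnorm A \<le> C"
  shows "\<bar>(A *v int_to_real_vec (round_vec x)) $ l - (A *v x) $ l\<bar> \<le> real CARD('n) * C / 2"
  using abs_matrix_vector_component_le[OF assms abs_round_vec_diff_le[of x]]
  by (simp add: matrix_vector_mult_diff_distrib)

section \<open>Integer boxes\<close>

definition int_box :: "nat \<Rightarrow> (int^'n) set" where
  "int_box N = {n. \<forall>i. \<bar>n $ i\<bar> \<le> int N}"

lemma int_box_eq_image: "int_box N = vec_lambda ` PiE UNIV (\<lambda>_. {- int N..int N})"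
proof (intro equalityI subsetI)
  fix n :: "int^'a" assume "n \<in> int_box N"
  then have "vec_nth n \<in> PiE UNIV (\<lambda>_. {- int N..int N})" "n = vec_lambda (vec_nth n)"
    by (auto simp: int_box_def abs_le_iff) (metis minus_le_iff)
  then show "n \<in> vec_lambda ` PiE UNIV (\<lambda>_. {- int N..int N})" by blast
qed (auto simp: int_box_def abs_le_iff PiE_iff minus_le_iff)

lemma finite_int_box [simp]: "finite (int_box N)"
  unfolding int_box_eq_image by (intro finite_imageI finite_PiE) auto

lemma card_int_box: "card (int_box N :: (int^'n) set) = (2 * N + 1) ^ CARD('n)"
proof -
  have "inj_on vec_lambda (PiE (UNIV :: 'n set) (\<lambda>_. {- int N..int N}))"
    by (simp add: inj_on_def vec_lambda_inject)
  moreover have "card {- int N..int N} = 2 * N + 1" by simp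
  ultimately show ?thesis unfolding int_box_eq_image
    by (simp add: card_image card_PiE del: card_atLeastAtMost_int)
qed

section \<open>Bounded vectors from nondegeneracy\<close>

lemma matrix_vector_mult_row: "(A *v x) $ i = row i A \<bullet> (x :: real^'n)"
  by (simp add: matrix_vector_mult_def row_def inner_vec_def)

lemma axis_vector_matrix_mult: "axis k 1 v* A = row k (A :: real^'n^'k)"
  by (simp add: vector_matrix_mult_def axis_def row_def vec_eq_iff if_distrib if_distribR cong: if_cong)

text \<open>Links the spans of the distance arguments with the functionals \<open>psi v* L\<close>
  in \<open>V_degen2\<close>.\<close>

lemma span_rows_subset_range: "span (rows L) \<subseteq> range (\<lambda>psi. psi v* (L :: real^'n^'k))"
proof (rule span_minimal)
  show "rows L \<subseteq> range (\<lambda>psi. psi v* L)"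
    by (auto simp: rows_def axis_vector_matrix_mult[symmetric])
  show "subspace (range (\<lambda>psi. psi v* L))"
    using linear_subspace_image[OF matrix_vector_mul_linear[of "transpose L"] subspace_UNIV] by simp
qed

text \<open>Moving the \<open>l\<close>-th row into the span of the other rows lowers the rank, so \<open>dist_rank_ge\<close>
  keeps each row at distance \<open>c\<close> from that span.\<close>

lemma bounded_right_inverse_column:
  fixes L :: "real^'h^'m"
  assumes L: "dist_rank_ge L c" and c: "c > 0"
  obtains v where "L *v v = axis l 1" "norm v \<le> 1 / c"
proof -
  define S where "S = (\<lambda>k. row k L) ` (- {l})"
  have "c \<le> norm (row l L - s)" if s: "s \<in> span S" for s
  proof (rule ccontr)
    assume less: "\<not> c \<le> norm (row l L - s)"
    define Q :: "real^'h^'m" where "Q = (\<chi> k. if k = l then s - row l L else 0)"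
    have "\<bar>(s - row l L) $ j\<bar> < c" for j
      using component_le_norm_cart[of "s - row l L" j] less by (simp add: norm_minus_commute)
    then have "mat_maxnorm Q < c"
      using c by (intro mat_maxnorm_less) (auto simp: Q_def)
    then have "L + Q \<notin> V_rank" using L by (simp add: dist_rank_ge_def)
    then have "rank (L + Q) = CARD('m)"
      using rank_bound[of "L + Q"] by (simp add: V_rank_def)
    moreover have "rows (L + Q) \<subseteq> span S"
    proof
      fix x assume "x \<in> rows (L + Q)"
      then obtain k where x: "x = row k (L + Q)" by (auto simp: rows_def)
      show "x \<in> span S"
      proof (cases "k = l")
        case True
        then have "x = s" unfolding x by (simp add: row_def Q_def vec_eq_iff)
        then show ?thesis using s by simp
      next
        case False
        then have "x = row k L" unfolding x by (simp add: row_def Q_def vec_eq_iff)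
        then show ?thesis using False by (auto simp: S_def intro: span_base)
      qed
    qed
    then have "rank (L + Q) \<le> card S"
      unfolding row_rank_def by (rule dim_le_card) (simp add: S_def)
    moreover have "card S \<le> card (- {l})" unfolding S_def by (rule card_image_le) simp
    moreover have "card (- {l}) < CARD('m)"
      by (simp add: Compl_eq_Diff_UNIV card_Diff_singleton)
    ultimately show False by simp
  qed
  then obtain v where v: "\<And>s. s \<in> S \<Longrightarrow> s \<bullet> v = 0" "row l L \<bullet> v = 1" "norm v \<le> 1 / c"
    using exists_dual_vector[of S c "row l L"] c by metis
  have "L *v v = axis l 1"
    using v(1,2) by (auto simp: vec_eq_iff matrix_vector_mult_row axis_def S_def)
  then show thesis using that v(3) by blast
qed

text \<open>If row \<open>j0\<close> of \<open>Xi\<close> were closer than \<open>c\<close> to the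
  span of row \<open>j\<close> and the rows of \<open>L\<close>, moving it into that span would be a
  perturbation below \<open>c\<close> that makes the pair degenerate. So
  \<open>exists_dual_vector\<close> applies to row \<open>j0\<close>.\<close>

lemma exists_kernel_vector:
  fixes Xi :: "real^'h^'d" and L :: "real^'h^'m"
  assumes nd: "dist_degen_ge Xi L c" and c: "c > 0" and ij: "j \<noteq> j0"
  obtains v where "L *v v = 0" "(Xi *v v) $ j = 0" "(Xi *v v) $ j0 = 1" "norm v \<le> 1 / c"
proof -
  define S where "S = insert (row j Xi) (rows L)"
  have "c \<le> norm (row j0 Xi - s)" if s: "s \<in> span S" for s
  proof (rule ccontr)
    assume less: "\<not> c \<le> norm (row j0 Xi - s)"
    \<comment> \<open>The coefficient of row \<open>j\<close> becomes the scalar in the degenerate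
      functional; row \<open>j\<close> itself is not moved, because
      \<open>j \<noteq> j0\<close>.\<close>
    obtain lam where "s - lam *\<^sub>R row j Xi \<in> span (rows L)"
      using s by (auto simp: S_def span_insert)
    then obtain psi where psi: "psi v* L = s - lam *\<^sub>R row j Xi"
      using span_rows_subset_range[of L] by (metis imageE subsetD)
    define Q :: "real^'h^'d" where "Q = (\<chi> k. if k = j0 then s - row j0 Xi else 0)"
    have "\<bar>(s - row j0 Xi) $ i\<bar> < c" for i
      using component_le_norm_cart[of "s - row j0 Xi" i] less by (simp add: norm_minus_commute)
    then have "mat_maxnorm Q < c"
      using c by (intro mat_maxnorm_less) (auto simp: Q_def)
    then have "(Xi + Q, L) \<notin> V_degen2" using nd by (simp add: dist_degen_ge_def)
    moreover have ne: "(axis j0 1 - lam *\<^sub>R axis j 1 :: real^'d) \<noteq> 0"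
      using ij by (auto simp: vec_eq_iff axis_def intro!: exI[of _ j0])
    moreover have "(axis j0 1 - lam *\<^sub>R axis j 1 :: real^'d) v* (Xi + Q) = psi v* L"
    proof -
      have "lam *\<^sub>R axis j 1 v* (Xi + Q) = lam *\<^sub>R row j (Xi + Q)"
        by (metis scaleR_vector_matrix_assoc axis_vector_matrix_mult)
      then show ?thesis using ij
        by (simp add: psi vector_matrix_mult_diff_distrib axis_vector_matrix_mult)
          (auto simp: row_def Q_def vec_eq_iff)
    qed
    ultimately show False unfolding V_degen2_def by blast
  qed
  then obtain v where v: "\<And>s. s \<in> S \<Longrightarrow> s \<bullet> v = 0" "row j0 Xi \<bullet> v = 1" "norm v \<le> 1 / c"
    using exists_dual_vector[of S c "row j0 Xi"] c by metis
  show thesis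
    by (rule that[of v]) (use v in \<open>auto simp: vec_eq_iff matrix_vector_mult_row S_def rows_def\<close>)
qed

section \<open>Counting lattice points with small image\<close>

text \<open>With \<open>A\<close> a bounded right inverse of \<open>L\<close>, the map \<open>(n, y) \<mapsto> n + round (D A y)\<close> is injective on
  the points counted times an integer box of dimension \<open>m\<close>, and takes values in an integer box of
  dimension \<open>h\<close>.\<close>

lemma card_small_image_le:
  fixes c C \<epsilon> :: real
  assumes c: "c > 0" and C: "C > 0" and eps: "\<epsilon> > 0" and mh: "CARD('m) \<le> CARD('h)"
  obtains K where "K > 0" "\<And>(L::real^'h^'m) N. mat_maxnorm L \<le> C \<Longrightarrow> dist_rank_ge L c \<Longrightarrow> N > 0 \<Longrightarrow>
    real (card {n \<in> int_box (2 * N). \<forall>l. \<bar>(L *v int_to_real_vec n) $ l\<bar> \<le> \<epsilon>})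
      \<le> K * real N ^ (CARD('h) - CARD('m))"
proof -
  \<comment> \<open>\<open>E\<close> is the bound \<epsilon> for the image of a point plus the
    rounding error. As \<open>D\<close> exceeds \<open>2 * E\<close>, equal sums
    \<open>n + round_vec (B y)\<close> will force equal \<open>y\<close>.\<close>
  define E where "E = \<epsilon> + real CARD('h) * C / 2"
  define D where "D = nat \<lceil>2 * E\<rceil> + 1"
  have D: "real D > 2 * E" unfolding D_def by linarith
  \<comment> \<open>In units of \<open>N\<close>: \<open>2\<close> from \<open>n\<close>, the
    fraction from \<open>B y\<close>, and \<open>1\<close> to absorb the rounding.\<close>
  define K where "K = 3 + nat \<lceil>real CARD('m) * real D / c\<rceil>"
  have K: "real K \<ge> 3 + real CARD('m) * real D / c" unfolding K_def by linarith
  have main: "real (card {n \<in> int_box (2 * N). \<forall>l. \<bar>(L *v int_to_real_vec n) $ l\<bar> \<le> \<epsilon>})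
      \<le> real (3 * K) ^ CARD('h) * real N ^ (CARD('h) - CARD('m))"
    if L: "mat_maxnorm L \<le> C" "dist_rank_ge L c" and N: "N > 0" for L :: "real^'h^'m" and N
  proof -
    define X where "X = {n \<in> int_box (2 * N). \<forall>l. \<bar>(L *v int_to_real_vec n) $ l\<bar> \<le> \<epsilon>}"
    have "\<exists>v. L *v v = axis l 1 \<and> norm v \<le> 1 / c" for l
      using bounded_right_inverse_column[OF L(2) c, of l] by metis
    then obtain A where A: "L *v A l = axis l 1" "norm (A l) \<le> 1 / c" for l
      by metis
    define B where "B y = (\<Sum>l\<in>UNIV. (real D * of_int (y $ l)) *\<^sub>R A l)" for y :: "int^'m"
    have LB: "(L *v B y) $ l = real D * of_int (y $ l)" for y l
    proof -
      have "L *v B y = (\<Sum>l\<in>UNIV. (real D * of_int (y $ l)) *\<^sub>R axis l 1)"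
        unfolding B_def by (simp add: linear_sum[OF matrix_vector_mul_linear] matrix_vector_mult_scaleR A)
      then show ?thesis by (simp add: axis_def if_distrib cong: if_cong)
    qed
    have Bbd: "\<bar>B y $ i\<bar> \<le> real CARD('m) * real D / c * real N" if y: "y \<in> int_box N" for y i
    proof -
      have "\<bar>B y $ i\<bar> \<le> (\<Sum>l\<in>UNIV. \<bar>(real D * of_int (y $ l)) * A l $ i\<bar>)"
        unfolding B_def by (simp add: sum_abs)
      also have "\<dots> \<le> (\<Sum>l\<in>(UNIV :: 'm set). (real D * real N) * (1 / c))"
      proof (rule sum_mono)
        fix l
        have "\<bar>y $ l\<bar> \<le> int N" using y by (simp add: int_box_def)
        then have "\<bar>real_of_int (y $ l)\<bar> \<le> real N" by linarith
        moreover have "\<bar>A l $ i\<bar> \<le> 1 / c"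
          using component_le_norm_cart[of "A l" i] A(2)[of l] by linarith
        ultimately show "\<bar>(real D * of_int (y $ l)) * A l $ i\<bar> \<le> (real D * real N) * (1 / c)"
          unfolding abs_mult by (intro mult_mono) auto
      qed
      finally show ?thesis by (simp add: mult_ac)
    qed
    define \<phi> where "\<phi> = (\<lambda>(n, y). n + round_vec (B y))"
    have "inj_on \<phi> (X \<times> int_box N)"
    proof (rule inj_onI)
      fix p q assume p: "p \<in> X \<times> int_box N" and q: "q \<in> X \<times> int_box N" and eq: "\<phi> p = \<phi> q"
      obtain n y n' y' where pq: "p = (n, y)" "q = (n', y')" by (metis surj_pair)
      have "int_to_real_vec n + int_to_real_vec (round_vec (B y))
          = int_to_real_vec n' + int_to_real_vec (round_vec (B y'))"
        using eq unfolding \<phi>_def pq by (simp flip: int_to_real_vec_add)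
      then have "L *v int_to_real_vec n + L *v int_to_real_vec (round_vec (B y))
          = L *v int_to_real_vec n' + L *v int_to_real_vec (round_vec (B y'))"
        by (metis matrix_vector_right_distrib)
      then have Leq: "(L *v int_to_real_vec n) $ l + (L *v int_to_real_vec (round_vec (B y))) $ l
          = (L *v int_to_real_vec n') $ l + (L *v int_to_real_vec (round_vec (B y'))) $ l" for l
        by (metis vector_add_component)
      have "y $ l = y' $ l" for l
      proof -
        have "\<bar>(L *v int_to_real_vec n) $ l\<bar> \<le> \<epsilon>" "\<bar>(L *v int_to_real_vec n') $ l\<bar> \<le> \<epsilon>"
          using p q pq by (auto simp: X_def)
        then have "\<bar>real D * of_int (y $ l) - real D * of_int (y' $ l)\<bar> \<le> 2 * E"
          using Leq[of l] abs_matrix_mult_round_vec_le[OF L(1), of "B y" l]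
            abs_matrix_mult_round_vec_le[OF L(1), of "B y'" l]
          unfolding LB E_def by (smt (verit))
        then have "real D * \<bar>of_int (y $ l - y' $ l)\<bar> < real D * 1"
          using D by (simp add: abs_mult flip: right_diff_distrib)
        then have "\<bar>real_of_int (y $ l - y' $ l)\<bar> < 1" by (rule mult_left_less_imp_less) simp
        then show ?thesis by linarith
      qed
      then have "y = y'" by (simp add: vec_eq_iff)
      then show "p = q" using eq unfolding \<phi>_def pq by simp
    qed
    moreover have "\<phi> ` (X \<times> int_box N) \<subseteq> int_box (K * N)"
    proof
      fix u assume "u \<in> \<phi> ` (X \<times> int_box N)"
      then obtain n y where u: "u = n + round_vec (B y)" "n \<in> X" "y \<in> int_box N"
        by (auto simp: \<phi>_def)
      have "\<bar>u $ i\<bar> \<le> int (K * N)" for i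
      proof -
        have "\<bar>n $ i\<bar> \<le> 2 * int N" using u(2) by (simp add: X_def int_box_def)
        then have "\<bar>real_of_int (n $ i)\<bar> \<le> 2 * real N" by linarith
        moreover have "real_of_int (u $ i) = of_int (n $ i) + of_int (round_vec (B y) $ i)"
          by (simp add: u(1))
        moreover have "\<bar>real_of_int (round_vec (B y) $ i) - B y $ i\<bar> \<le> 1 / 2"
          using abs_round_vec_diff_le[of "B y" i] by simp
        moreover have "1 \<le> real N" using N by simp
        ultimately have "\<bar>real_of_int (u $ i)\<bar> \<le> 2 * real N + real CARD('m) * real D / c * real N + 1 * real N"
          using Bbd[OF u(3), of i] by linarith
        also have "\<dots> = (3 + real CARD('m) * real D / c) * real N" by (simp add: algebra_simps)
        also have "\<dots> \<le> real K * real N" by (intro mult_right_mono K) simp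
        finally have "\<bar>real_of_int (u $ i)\<bar> \<le> real_of_int (int (K * N))" by simp
        then show ?thesis by linarith
      qed
      then show "u \<in> int_box (K * N)" by (simp add: int_box_def)
    qed
    ultimately have "card (X \<times> (int_box N :: (int^'m) set)) \<le> card (int_box (K * N) :: (int^'h) set)"
      by (rule card_inj_on_le) simp
    then have "real (card X) * real (2 * N + 1) ^ CARD('m) \<le> real (2 * (K * N) + 1) ^ CARD('h)"
      unfolding card_cartesian_product card_int_box by (metis of_nat_le_iff of_nat_mult of_nat_power)
    also have "\<dots> \<le> real (3 * K * N) ^ CARD('h)"
    proof (rule power_mono)
      have "K * N \<ge> 1" using N by (simp add: K_def)
      then have "2 * (K * N) + 1 \<le> 3 * K * N" by simp
      then show "real (2 * (K * N) + 1) \<le> real (3 * K * N)" by (rule of_nat_mono)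
    qed simp
    also have "\<dots> = real (3 * K) ^ CARD('h) * real N ^ (CARD('h) - CARD('m)) * real N ^ CARD('m)"
      using mh by (simp add: power_mult_distrib flip: power_add)
    finally have "real (card X) * real (2 * N + 1) ^ CARD('m)
      \<le> real (3 * K) ^ CARD('h) * real N ^ (CARD('h) - CARD('m)) * real N ^ CARD('m)" .
    \<comment> \<open>Lowering \<open>2 * N + 1\<close> to \<open>N\<close> makes the power cancel
      and leaves the exponent \<open>CARD('h) - CARD('m)\<close>.\<close>
    moreover have "real (card X) * real N ^ CARD('m) \<le> real (card X) * real (2 * N + 1) ^ CARD('m)"
      by (intro mult_left_mono power_mono) auto
    ultimately have "real (card X) * real N ^ CARD('m)
      \<le> real (3 * K) ^ CARD('h) * real N ^ (CARD('h) - CARD('m)) * real N ^ CARD('m)" by linarith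
    then show ?thesis unfolding X_def[symmetric]
      by (rule mult_right_le_imp_le) (use N in simp)
  qed
  show thesis
    by (rule that[of "real (3 * K) ^ CARD('h)"]) (use main in \<open>auto simp: K_def\<close>)
qed

section \<open>Pigeonhole and admissible shifts\<close>

lemma exists_large_fibre:
  assumes "finite A" "finite T" "f ` A \<subseteq> T" "T \<noteq> {}"
  obtains t where "real (card A) \<le> real (card T) * real (card {a \<in> A. f a = t})"
proof (rule ccontr)
  assume "\<not> thesis"
  then have less: "real (card T) * real (card {a \<in> A. f a = t}) < real (card A)" for t
    using that not_le by blast
  have "real (card A) = (\<Sum>t\<in>T. real (card {a \<in> A. f a = t}))"
    using sum.group[OF assms(1-3), of "\<lambda>_. 1::real"] by simp
  then have "real (card T) * real (card A) = (\<Sum>t\<in>T. real (card T) * real (card {a \<in> A. f a = t}))"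
    by (simp add: sum_distrib_left)
  also have "\<dots> < (\<Sum>t\<in>T. real (card A))"
    using assms(2,4) less by (intro sum_strict_mono) auto
  finally show False by simp
qed

text \<open>Round the multiples \<open>s D v\<close> of a real vector \<open>v\<close> in the kernels of \<open>L\<close> and of the \<open>j\<close>-th form on
  which the \<open>j0\<close>-th form is \<open>1\<close>; two of the rounded points in the same pigeonhole differ by an
  admissible shift.\<close>

lemma exists_shift_section:
  fixes c C :: real
  assumes c: "c > 0" and C: "C > 0"
  obtains \<kappa> R where "\<kappa> > 0" "R > 0"
    "\<And>(Xi::int^'h^'d) (L::real^'h^'m) j j0 \<delta> N M.
      mat_maxnorm (int_to_real_mat Xi) \<le> C \<Longrightarrow> mat_maxnorm L \<le> C \<Longrightarrow>
      dist_degen_ge (int_to_real_mat Xi) L c \<Longrightarrow> j \<noteq> j0 \<Longrightarrow> 0 < \<delta> \<Longrightarrow> \<delta> \<le> 1 \<Longrightarrow>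
      real CARD('h) * C * \<delta> \<le> 1 \<Longrightarrow> R \<le> \<delta> * real N \<Longrightarrow> 2 * N < M \<Longrightarrow>
      \<exists>B w. B \<subseteq> {0..<int M} \<and> \<kappa> * \<delta> ^ (CARD('m) + 1) * real N \<le> real (card B) \<and>
        (\<forall>y\<in>B. (Xi *v w y) $ j0 mod int M = y \<and> (Xi *v w y) $ j = 0 \<and>
          (\<forall>i. \<bar>real_of_int (w y $ i)\<bar> \<le> \<delta> * real N) \<and>
          (\<forall>l. \<bar>(L *v int_to_real_vec (w y)) $ l\<bar> \<le> \<delta>))"
proof -
  define H where "H = real CARD('h) * C"
  have H0: "H > 0" using C by (simp add: H_def)
  \<comment> \<open>\<open>D\<close> exceeds the combined rounding error of two points, which later
    separates the values of the \<open>j0\<close>-th form; it also bounds the values of the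
    \<open>j\<close>-th form.\<close>
  define D where "D = nat \<lceil>H\<rceil> + 1"
  have D: "real D > H" "D > 0" unfolding D_def by linarith+
  \<comment> \<open>\<open>U / \<delta>\<close> will bound the side \<open>2 * Q + 1\<close> of the
    box of pigeonholes for \<open>L\<close>. The constant \<open>\<kappa>\<close> is the number of
    multiples over the number of pigeonholes, stripped of the powers of \<delta> and
    \<open>N\<close>.\<close>
  define U where "U = 2 * H + 5"
  define \<kappa> where "\<kappa> = c / (4 * real D * (2 * real D + 1) * U ^ CARD('m))"
  \<comment> \<open>\<open>2 * real D / c\<close> guarantees at least one multiple, and
    \<open>2\<close> lets half of \<open>\<delta> * real N\<close> absorb the rounding of two
    points.\<close>
  define R where "R = max 2 (2 * real D / c)"
  have U0: "U > 0" using H0 by (simp add: U_def)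
  have main: "\<exists>B w. B \<subseteq> {0..<int M} \<and> \<kappa> * \<delta> ^ (CARD('m) + 1) * real N \<le> real (card B) \<and>
        (\<forall>y\<in>B. (Xi *v w y) $ j0 mod int M = y \<and> (Xi *v w y) $ j = 0 \<and>
          (\<forall>i. \<bar>real_of_int (w y $ i)\<bar> \<le> \<delta> * real N) \<and>
          (\<forall>l. \<bar>(L *v int_to_real_vec (w y)) $ l\<bar> \<le> \<delta>))"
    if Xi: "mat_maxnorm (int_to_real_mat Xi) \<le> C" and L: "mat_maxnorm L \<le> C"
      and nd: "dist_degen_ge (int_to_real_mat Xi) L c" and j: "j \<noteq> j0"
      and d: "0 < \<delta>" "\<delta> \<le> 1" and Cd: "real CARD('h) * C * \<delta> \<le> 1" and RN: "R \<le> \<delta> * real N"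
      and M: "2 * N < M"
    for Xi :: "int^'h^'d" and L :: "real^'h^'m" and j j0 and \<delta> :: real and N M :: nat
  proof -
    let ?X = "int_to_real_mat Xi"
    obtain v where v: "L *v v = 0" "(?X *v v) $ j = 0" "(?X *v v) $ j0 = 1" "norm v \<le> 1 / c"
      using exists_kernel_vector[OF nd c j] by metis
    define u where "u s = round_vec ((real s * real D) *\<^sub>R v)" for s :: nat
    define Q where "Q = nat \<lceil>H / \<delta>\<rceil> + 1"
    \<comment> \<open>The pigeonhole of \<open>s\<close> records the \<open>j\<close>-th form
      exactly and the image under \<open>L\<close> up to cells of side \<delta>.\<close>
    define f where "f s = ((Xi *v u s) $ j, (\<chi> l. \<lfloor>(L *v int_to_real_vec (u s)) $ l / \<delta>\<rfloor>) :: int^'m)" for s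
    \<comment> \<open>So many multiples stay within \<open>\<delta> * real N / 2\<close> in each
      coordinate, as the entries of \<open>v\<close> are at most \<open>1 / c\<close> in
      size.\<close>
    define S where "S = nat \<lfloor>\<delta> * real N * c / (2 * real D)\<rfloor>"
    have Lu: "\<bar>(L *v int_to_real_vec (u s)) $ l\<bar> \<le> H / 2" for s l
      using abs_matrix_mult_round_vec_le[OF L, of "(real s * real D) *\<^sub>R v" l]
      by (simp add: u_def H_def matrix_vector_mult_scaleR v)
    have Xu: "\<bar>(?X *v int_to_real_vec (u s)) $ j\<bar> \<le> H / 2"
      "\<bar>(?X *v int_to_real_vec (u s)) $ j0 - real s * real D\<bar> \<le> H / 2" for s
      using abs_matrix_mult_round_vec_le[OF Xi, of "(real s * real D) *\<^sub>R v" j]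
        abs_matrix_mult_round_vec_le[OF Xi, of "(real s * real D) *\<^sub>R v" j0]
      by (simp_all add: u_def H_def matrix_vector_mult_scaleR v)
    have "f ` {..<S} \<subseteq> {- int D..int D} \<times> int_box Q"
    proof -
      have "\<bar>(Xi *v u s) $ j\<bar> \<le> int D" for s
        using Xu(1)[of s] D(1) H0 unfolding int_to_real_mat_mult by linarith
      then have "(Xi *v u s) $ j \<in> {- int D..int D}" for s
        by (metis abs_le_D1 abs_le_D2 atLeastAtMost_iff minus_le_iff)
      moreover have "\<bar>\<lfloor>(L *v int_to_real_vec (u s)) $ l / \<delta>\<rfloor>\<bar> \<le> int Q" for s l
      proof -
        have "\<bar>(L *v int_to_real_vec (u s)) $ l / \<delta>\<bar> \<le> H / \<delta>"
          using Lu[of s l] H0 d(1) by (simp add: divide_right_mono)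
        then show ?thesis unfolding Q_def by linarith
      qed
      ultimately show ?thesis by (auto simp: f_def int_box_def simp del: atLeastAtMost_iff)
    qed
    then obtain t where t: "real (card {..<S}) \<le>
        real (card ({- int D..int D} \<times> (int_box Q :: (int^'m) set))) * real (card {s \<in> {..<S}. f s = t})"
    proof (rule exists_large_fibre[rotated 2])
      have "(0, 0) \<in> {- int D..int D} \<times> (int_box Q :: (int^'m) set)" by (simp add: int_box_def)
      then show "{- int D..int D} \<times> (int_box Q :: (int^'m) set) \<noteq> {}" by blast
    qed auto
    define W where "W = {s \<in> {..<S}. f s = t}"
    have "real (card ({- int D..int D} \<times> (int_box Q :: (int^'m) set)))
        = (2 * real D + 1) * (2 * real Q + 1) ^ CARD('m)"
      by (simp add: card_cartesian_product card_int_box nat_add_distrib nat_mult_distrib add_ac)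
        (simp add: algebra_simps)
    also have "\<dots> \<le> (2 * real D + 1) * (U / \<delta>) ^ CARD('m)"
    proof (intro mult_left_mono power_mono)
      have "H / \<delta> \<ge> 0" using H0 d by simp
      then have "real (nat \<lceil>H / \<delta>\<rceil>) = of_int \<lceil>H / \<delta>\<rceil>" by simp
      then have "2 * real Q + 1 \<le> 2 * (H / \<delta>) + 5"
        using ceiling_correct[of "H / \<delta>"] by (simp add: Q_def)
      also have "5 \<le> 5 / \<delta>" using d by (simp add: divide_simps)
      finally show "2 * real Q + 1 \<le> U / \<delta>" by (simp add: U_def add_divide_distrib)
    qed auto
    finally have "real (card ({- int D..int D} \<times> (int_box Q :: (int^'m) set)))
        \<le> (2 * real D + 1) * (U / \<delta>) ^ CARD('m)" .
    from order.trans[OF t mult_right_mono[OF this]]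
    have "real S \<le> (2 * real D + 1) * (U / \<delta>) ^ CARD('m) * real (card W)"
      by (simp add: W_def)
    \<comment> \<open>The floor of a number that is at least \<open>1\<close> loses at most a factor
      \<open>2\<close>.\<close>
    moreover have S2: "\<delta> * real N * c / (4 * real D) \<le> real S" "real S \<le> \<delta> * real N * c / (2 * real D)" "S > 0"
    proof -
      have "2 * real D / c \<le> \<delta> * real N" using RN by (simp add: R_def)
      then have "1 \<le> \<delta> * real N * c / (2 * real D)" using c D(2) by (simp add: divide_simps)
      moreover have "x / 2 \<le> real (nat \<lfloor>x\<rfloor>)" "real (nat \<lfloor>x\<rfloor>) \<le> x" "nat \<lfloor>x\<rfloor> > 0" if "1 \<le> x" for x :: real
      proof -
        have "1 \<le> \<lfloor>x\<rfloor>" using that by simp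
        then have "real (nat \<lfloor>x\<rfloor>) = of_int \<lfloor>x\<rfloor>" "nat \<lfloor>x\<rfloor> > 0" by auto
        moreover have "real_of_int \<lfloor>x\<rfloor> \<ge> 1" using \<open>1 \<le> \<lfloor>x\<rfloor>\<close> by linarith
        ultimately show "x / 2 \<le> real (nat \<lfloor>x\<rfloor>)" "real (nat \<lfloor>x\<rfloor>) \<le> x" "nat \<lfloor>x\<rfloor> > 0"
          using floor_correct[of x] by linarith+
      qed
      moreover have "\<delta> * real N * c / (4 * real D) = (\<delta> * real N * c / (2 * real D)) / 2" by simp
      ultimately show "\<delta> * real N * c / (4 * real D) \<le> real S" "real S \<le> \<delta> * real N * c / (2 * real D)" "S > 0"
        unfolding S_def by metis+
    qed
    ultimately have cW: "\<delta> * real N * c / (4 * real D)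
        \<le> (2 * real D + 1) * (U / \<delta>) ^ CARD('m) * real (card W)" by linarith
    have "\<kappa> * \<delta> ^ (CARD('m) + 1) * real N
        = \<delta> * real N * c / (4 * real D) / ((2 * real D + 1) * (U / \<delta>) ^ CARD('m))"
      unfolding \<kappa>_def using d by (simp add: power_divide field_simps)
    also have "\<dots> \<le> real (card W)"
    proof -
      have "(2 * real D + 1) * (U / \<delta>) ^ CARD('m) > 0" using U0 d by simp
      then show ?thesis by (rule pos_divide_le_eq[THEN iffD2]) (use cW in \<open>simp only: mult.commute\<close>)
    qed
    finally have cardW: "\<kappa> * \<delta> ^ (CARD('m) + 1) * real N \<le> real (card W)" .
    have "card W \<noteq> 0"
    proof
      assume "card W = 0"
      then show False using cW S2(2,3) by simp
    qed
    then have "card W > 0" by simp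
    then obtain s0 where s0: "s0 \<in> W" by (metis card_gt_0_iff ex_in_conv)
    \<comment> \<open>Subtracting a fixed member of the fibre annihilates the \<open>j\<close>-th
      form and leaves an image under \<open>L\<close> of size at most \<delta>.\<close>
    define z where "z s = u s - u s0" for s
    have same: "(Xi *v u s) $ j = (Xi *v u s0) $ j"
      "\<lfloor>(L *v int_to_real_vec (u s)) $ l / \<delta>\<rfloor> = \<lfloor>(L *v int_to_real_vec (u s0)) $ l / \<delta>\<rfloor>"
      if "s \<in> W" for s l
      using that s0 by (auto simp: W_def f_def vec_eq_iff)
    have z1: "(Xi *v z s) $ j = 0" if "s \<in> W" for s
      using same(1)[OF that] by (simp add: z_def matrix_vector_mult_def right_diff_distrib sum_subtractf)
    have z2: "\<bar>(L *v int_to_real_vec (z s)) $ l\<bar> \<le> \<delta>" if "s \<in> W" for s l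
    proof -
      have "\<bar>(L *v int_to_real_vec (u s)) $ l / \<delta> - (L *v int_to_real_vec (u s0)) $ l / \<delta>\<bar> \<le> 1"
        using same(2)[OF that, of l] by linarith
      then have "\<bar>(L *v int_to_real_vec (u s)) $ l - (L *v int_to_real_vec (u s0)) $ l\<bar> \<le> \<delta>"
        using d by (simp add: divide_simps flip: diff_divide_distrib)
      then show ?thesis by (simp add: z_def int_to_real_vec_diff matrix_vector_mult_diff_distrib)
    qed
    have z3: "\<bar>real_of_int (z s $ i)\<bar> \<le> \<delta> * real N" if "s \<in> W" for s i
    proof -
      have vi: "\<bar>v $ i\<bar> \<le> 1 / c" using component_le_norm_cart[of v i] v(4) by linarith
      have tri: "\<bar>x - y\<bar> \<le> \<bar>a - b\<bar> + 1" if "\<bar>x - a\<bar> \<le> 1 / 2" "\<bar>y - b\<bar> \<le> 1 / 2" for x y a b :: real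
        using that by linarith
      have r: "\<bar>real_of_int (u s $ i) - real s * real D * v $ i\<bar> \<le> 1 / 2" for s
        using abs_round_vec_diff_le[of "(real s * real D) *\<^sub>R v" i] by (simp add: u_def)
      have "real_of_int (z s $ i) = of_int (u s $ i) - of_int (u s0 $ i)" by (simp add: z_def)
      then have "\<bar>real_of_int (z s $ i)\<bar> \<le> \<bar>real s * real D * v $ i - real s0 * real D * v $ i\<bar> + 1"
        using tri[OF r[of s] r[of s0]] by simp
      also have "\<bar>real s * real D * v $ i - real s0 * real D * v $ i\<bar> = \<bar>(real s - real s0) * real D * v $ i\<bar>"
        by (simp only: left_diff_distrib)
      also have "\<dots> = \<bar>real s - real s0\<bar> * real D * \<bar>v $ i\<bar>" by (simp add: abs_mult)
      also have "\<dots> \<le> real S * real D * (1 / c)"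
        using that s0 vi by (intro mult_mono) (auto simp: W_def)
      also have "\<dots> \<le> (\<delta> * real N * c / (2 * real D)) * real D * (1 / c)"
        using S2 c by (intro mult_right_mono) auto
      also have "\<dots> = \<delta> * real N / 2" using c D by simp
      finally show ?thesis using RN by (simp add: R_def)
    qed
    have z4: "\<bar>(Xi *v z s) $ j0\<bar> \<le> int N" if "s \<in> W" for s
    proof -
      have "\<bar>(?X *v int_to_real_vec (z s)) $ j0\<bar> \<le> real CARD('h) * C * (\<delta> * real N)"
        by (rule abs_matrix_vector_component_le[OF Xi]) (simp add: z3[OF that])
      also have "\<dots> = (real CARD('h) * C * \<delta>) * real N" by simp
      also have "\<dots> \<le> 1 * real N" by (intro mult_right_mono Cd) simp
      finally show ?thesis unfolding int_to_real_mat_mult by linarith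
    qed
    \<comment> \<open>Values of the \<open>j0\<close>-th form have size at most \<open>N\<close> and
      \<open>2 * N < M\<close>, so equal residues mean equal values; the spacing
      \<open>D > H\<close> then gives \<open>s = s'\<close>.\<close>
    have inj: "inj_on (\<lambda>s. (Xi *v z s) $ j0 mod int M) W"
    proof (rule inj_onI)
      fix s s' assume s: "s \<in> W" "s' \<in> W" and eq: "(Xi *v z s) $ j0 mod int M = (Xi *v z s') $ j0 mod int M"
      have "int M dvd (Xi *v z s) $ j0 - (Xi *v z s') $ j0" using eq by (simp add: mod_eq_dvd_iff)
      moreover have "\<bar>(Xi *v z s) $ j0 - (Xi *v z s') $ j0\<bar> < int M"
        using z4[OF s(1)] z4[OF s(2)] M by linarith
      ultimately have "(Xi *v z s) $ j0 = (Xi *v z s') $ j0"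
        by (metis dvd_imp_le_int eq_iff_diff_eq_0 abs_of_nat not_le)
      then have "(Xi *v u s) $ j0 = (Xi *v u s') $ j0"
        by (simp add: z_def matrix_vector_mult_def right_diff_distrib sum_subtractf)
      then have "\<bar>real s * real D - real s' * real D\<bar> \<le> H"
        using Xu(2)[of s] Xu(2)[of s'] unfolding int_to_real_mat_mult by linarith
      then have "\<bar>real s - real s'\<bar> * real D < 1 * real D"
        using D(1) by (simp add: abs_mult flip: left_diff_distrib)
      then have "\<bar>real s - real s'\<bar> < 1" by (rule mult_right_less_imp_less) simp
      then show "s = s'" by linarith
    qed
    \<comment> \<open>Shifts are indexed by the residue of their \<open>j0\<close>-th form, and
      \<open>w\<close> is a section of that map.\<close>
    define B where "B = (\<lambda>s. (Xi *v z s) $ j0 mod int M) ` W"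
    define w where "w y = z (inv_into W (\<lambda>s. (Xi *v z s) $ j0 mod int M) y)" for y
    have "B \<subseteq> {0..<int M}" using M by (auto simp: B_def)
    moreover have "card B = card W" unfolding B_def by (rule card_image[OF inj])
    moreover have "(Xi *v w y) $ j0 mod int M = y \<and> (Xi *v w y) $ j = 0 \<and>
          (\<forall>i. \<bar>real_of_int (w y $ i)\<bar> \<le> \<delta> * real N) \<and>
          (\<forall>l. \<bar>(L *v int_to_real_vec (w y)) $ l\<bar> \<le> \<delta>)" if yB: "y \<in> B" for y
    proof -
      obtain s where s: "s \<in> W" "y = (Xi *v z s) $ j0 mod int M" using yB unfolding B_def by blast
      then have "w y = z s" unfolding w_def by (simp add: inv_into_f_f[OF inj])
      then show ?thesis using s z1 z2 z3 by simp
    qed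
    ultimately show ?thesis using cardW by (intro exI[of _ B] exI[of _ w]) simp
  qed
  have "\<kappa> > 0" "R > 0" using c D(2) U0 by (auto simp: \<kappa>_def R_def)
  then show thesis by (rule that) (fact main)
qed

section \<open>Averaging the count over shifts\<close>

text \<open>The factor \<open>f (e i)\<close> does not depend on the \<open>i\<close>-th shift, and the indicator of \<open>y i \<in> B i\<close> can
  be attached to any of the other factors because \<open>k \<ge> 2\<close>; this lets the sum over the sections be
  extended to all of \<open>\<int>/M\<int>\<close>.\<close>

lemma abs_section_sum_le:
  fixes f :: "'d::finite \<Rightarrow> int \<Rightarrow> real" and \<tau> :: "'d \<Rightarrow> nat \<Rightarrow> int \<Rightarrow> int" and M N k :: nat
  assumes k: "k \<ge> 2" and e: "bij_betw e {..<k} (UNIV - {j0})" and M: "4 * N < M"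
    and B: "\<And>i. i < k \<Longrightarrow> B i \<subseteq> {0..<int M}"
    and \<tau>: "\<And>i y. i < k \<Longrightarrow> y \<in> B i \<Longrightarrow> \<tau> (e i) i y = 0"
      "\<And>i y. i < k \<Longrightarrow> y \<in> B i \<Longrightarrow> \<tau> j0 i y mod int M = y"
      "\<And>y. y \<in> PiE {..<k} B \<Longrightarrow> \<bar>\<Sum>i<k. \<tau> j0 i (y i)\<bar> \<le> int N"
    and f: "\<And>j x. \<bar>f j x\<bar> \<le> 1" "\<And>j x. x \<notin> {1..int N} \<Longrightarrow> f j x = 0"
    and \<rho>: "gowers_ZN M k (f j0) \<le> \<rho>" "0 \<le> \<rho>"
  shows "\<bar>\<Sum>y\<in>PiE {..<k} B. \<Prod>j\<in>UNIV. f j (a j + (\<Sum>i<k. \<tau> j i (y i)))\<bar> \<le> real M ^ k * \<rho>"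
proof (cases "\<bar>a j0\<bar> \<le> 2 * int N")
  \<comment> \<open>Shifts move the argument by at most \<open>N\<close>, so from beyond
    \<open>2 * N\<close> it never reaches \<open>{1..int N}\<close>.\<close>
  case False
  have "(\<Prod>j\<in>UNIV. f j (a j + (\<Sum>i<k. \<tau> j i (y i)))) = 0" if "y \<in> PiE {..<k} B" for y
  proof -
    have "a j0 + (\<Sum>i<k. \<tau> j0 i (y i)) \<notin> {1..int N}"
      using \<tau>(3)[OF that] False by (auto simp: abs_le_iff abs_if split: if_splits)
    then have "f j0 (a j0 + (\<Sum>i<k. \<tau> j0 i (y i))) = 0" by (rule f(2))
    then show ?thesis by (intro prod_zero) auto
  qed
  then have "(\<Sum>y\<in>PiE {..<k} B. \<Prod>j\<in>UNIV. f j (a j + (\<Sum>i<k. \<tau> j i (y i)))) = 0"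
    by (intro sum.neutral) auto
  then show ?thesis using \<rho>(2) by simp
next
  case True
  \<comment> \<open>The default \<open>0\<close> encodes the indicator of the sections in all
    coordinates but \<open>i\<close>; leaving out \<open>i\<close> keeps \<open>b i\<close>
    independent of \<open>y i\<close>.\<close>
  define b where "b i y = (if \<forall>i'\<in>{..<k} - {i}. y i' \<in> B i' then
     f (e i) (a (e i) + (\<Sum>i'\<in>{..<k} - {i}. \<tau> (e i) i' (y i'))) else 0)" for i and y :: "nat \<Rightarrow> int"
  have b1: "\<bar>b i y\<bar> \<le> 1" for i y using f(1) by (simp add: b_def)
  have b2: "b i (y(i := z)) = b i y" for i y z
  proof -
    have "(\<Sum>i'\<in>{..<k} - {i}. \<tau> (e i) i' ((y(i := z)) i')) = (\<Sum>i'\<in>{..<k} - {i}. \<tau> (e i) i' (y i'))"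
      by (intro sum.cong) auto
    then show ?thesis by (simp add: b_def)
  qed
  have eq: "(\<Prod>j\<in>UNIV. f j (a j + (\<Sum>i<k. \<tau> j i (y i)))) =
      f j0 ((a j0 + (\<Sum>i<k. y i)) mod int M) * (\<Prod>i<k. b i y)" if y: "y \<in> PiE {..<k} B" for y
  proof -
    have yB: "y i \<in> B i" if "i < k" for i using y that by auto
    have "(\<Prod>j\<in>UNIV. f j (a j + (\<Sum>i<k. \<tau> j i (y i)))) =
        f j0 (a j0 + (\<Sum>i<k. \<tau> j0 i (y i))) * (\<Prod>j\<in>UNIV - {j0}. f j (a j + (\<Sum>i<k. \<tau> j i (y i))))"
      by (rule prod.remove) auto
    also have "(\<Prod>j\<in>UNIV - {j0}. f j (a j + (\<Sum>i<k. \<tau> j i (y i)))) =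
        (\<Prod>i<k. f (e i) (a (e i) + (\<Sum>i'<k. \<tau> (e i) i' (y i'))))"
      using prod.reindex_bij_betw[OF e, of "\<lambda>j. f j (a j + (\<Sum>i<k. \<tau> j i (y i)))"] by simp
    also have "\<dots> = (\<Prod>i<k. b i y)"
    proof (rule prod.cong[OF refl])
      fix i assume i: "i \<in> {..<k}"
      have "(\<Sum>i'<k. \<tau> (e i) i' (y i')) = (\<Sum>i'\<in>{..<k} - {i}. \<tau> (e i) i' (y i'))"
        using i \<tau>(1)[of i "y i"] yB by (subst sum.remove[of _ i]) auto
      then show "f (e i) (a (e i) + (\<Sum>i'<k. \<tau> (e i) i' (y i'))) = b i y"
        using yB by (simp add: b_def)
    qed
    also have "f j0 (a j0 + (\<Sum>i<k. \<tau> j0 i (y i))) = f j0 ((a j0 + (\<Sum>i<k. y i)) mod int M)"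
    proof -
      \<comment> \<open>Here \<open>\<bar>x\<bar> \<le> 3 * N\<close> and \<open>4 * N < M\<close>:
        a negative \<open>x\<close> wraps to \<open>x + M > N\<close>, outside the support, and a
        nonnegative one is unchanged.\<close>
      define x where "x = a j0 + (\<Sum>i<k. \<tau> j0 i (y i))"
      have "(\<Sum>i<k. y i) = (\<Sum>i<k. \<tau> j0 i (y i) mod int M)"
        using \<tau>(2) yB by (intro sum.cong) auto
      then have "(\<Sum>i<k. y i) mod int M = (\<Sum>i<k. \<tau> j0 i (y i)) mod int M"
        by (simp add: mod_sum_eq)
      then have xm: "(a j0 + (\<Sum>i<k. y i)) mod int M = x mod int M"
        unfolding x_def by (metis mod_add_right_eq)
      have xb: "- (3 * int N) \<le> x" "x \<le> 3 * int N"
        using \<tau>(3)[OF y] True by (auto simp: x_def)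
      have "f j0 (x mod int M) = f j0 x"
      proof (cases "x \<ge> 0")
        case True
        then show ?thesis using xb M by simp
      next
        case False
        have "x mod int M = (x + int M) mod int M" by simp
        also have "\<dots> = x + int M" using False xb M by (intro mod_pos_pos_trivial) auto
        finally have "x mod int M \<notin> {1..int N}" "x \<notin> {1..int N}" using False xb M by auto
        then show ?thesis by (simp add: f(2))
      qed
      then show ?thesis unfolding xm x_def[symmetric] by simp
    qed
    finally show ?thesis .
  qed
  have "(\<Sum>y\<in>PiE {..<k} (\<lambda>_. {0..<int M}). f j0 ((a j0 + (\<Sum>i<k. y i)) mod int M) * (\<Prod>i<k. b i y))
      = (\<Sum>y\<in>PiE {..<k} B. f j0 ((a j0 + (\<Sum>i<k. y i)) mod int M) * (\<Prod>i<k. b i y))"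
  proof (rule sum.mono_neutral_right)
    show "PiE {..<k} B \<subseteq> PiE {..<k} (\<lambda>_. {0..<int M})" using B by (intro PiE_mono) auto
    show "\<forall>y\<in>PiE {..<k} (\<lambda>_. {0..<int M}) - PiE {..<k} B.
        f j0 ((a j0 + (\<Sum>i<k. y i)) mod int M) * (\<Prod>i<k. b i y) = 0"
    proof
      fix y assume "y \<in> PiE {..<k} (\<lambda>_. {0..<int M}) - PiE {..<k} B"
      then obtain i where i: "i < k" "y i \<notin> B i" by (auto simp: PiE_iff)
      \<comment> \<open>Since \<open>k \<ge> 2\<close> there is a second index, whose weight detects
        that \<open>y i\<close> lies outside \<open>B i\<close>.\<close>
      obtain i' where i': "i' < k" "i' \<noteq> i"
        using k by (metis One_nat_def Suc_1 Suc_le_eq less_trans zero_less_one zero_neq_one)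
      have "b i' y = 0" using i i' by (auto simp: b_def)
      then show "f j0 ((a j0 + (\<Sum>i<k. y i)) mod int M) * (\<Prod>i<k. b i y) = 0"
        using i' by (auto simp: prod_zero_iff)
    qed
  qed (auto intro: finite_PiE)
  also have "\<dots> = (\<Sum>y\<in>PiE {..<k} B. \<Prod>j\<in>UNIV. f j (a j + (\<Sum>i<k. \<tau> j i (y i))))"
    by (rule sum.cong) (simp_all add: eq)
  finally show ?thesis
    using weighted_sum_le_gowers[OF _ _ b1 b2 \<rho>, of "a j0"] M k by simp
qed

text \<open>The sum over \<open>n\<close> is invariant under translation by
  \<open>\<sigma> y\<close>. Averaging over \<open>y\<close>, the smooth factor
  \<open>\<Phi>\<close> is replaced by its unshifted value at cost \<open>err\<close>, and
  \<open>abs_section_sum_le\<close> bounds what remains for each \<open>n\<close> separately. Both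
  sides keep the number of shifts as a factor, so no division occurs.\<close>

lemma abs_weighted_count_le:
  fixes Xi :: "int^'h^'d" and L :: "real^'h^'m" and f :: "'d \<Rightarrow> int \<Rightarrow> real" and M N k :: nat
    and w :: "nat \<Rightarrow> int \<Rightarrow> int^'h" and \<delta> \<epsilon> lF lG :: real
  assumes k: "k \<ge> 2" and e: "bij_betw e {..<k} (UNIV - {j0})" and M: "4 * N < M"
    and B: "\<And>i. i < k \<Longrightarrow> B i \<subseteq> {0..<int M}"
    and w: "\<And>i y. i < k \<Longrightarrow> y \<in> B i \<Longrightarrow> (Xi *v w i y) $ j0 mod int M = y"
      "\<And>i y. i < k \<Longrightarrow> y \<in> B i \<Longrightarrow> (Xi *v w i y) $ e i = 0"
      "\<And>i y p. i < k \<Longrightarrow> y \<in> B i \<Longrightarrow> \<bar>real_of_int (w i y $ p)\<bar> \<le> \<delta> * real N"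
      "\<And>i y l. i < k \<Longrightarrow> y \<in> B i \<Longrightarrow> \<bar>(L *v int_to_real_vec (w i y)) $ l\<bar> \<le> \<delta>"
    and \<delta>: "0 \<le> \<delta>" "real k * \<delta> \<le> 1"
    and Xi: "mat_maxnorm (int_to_real_mat Xi) \<le> C" "real CARD('h) * C * (real k * \<delta>) \<le> 1"
    and F: "\<And>x. 0 \<le> F x \<and> F x \<le> 1" "\<And>x. F x \<noteq> 0 \<Longrightarrow> \<forall>i. \<bar>x $ i\<bar> \<le> real N"
      "\<And>x y. \<bar>F x - F y\<bar> \<le> lF * vec_maxnorm (x - y)" "lF \<ge> 0"
    and G: "\<And>x. 0 \<le> G x \<and> G x \<le> 1" "\<And>x. G x \<noteq> 0 \<Longrightarrow> \<forall>i. \<bar>x $ i\<bar> \<le> \<epsilon>"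
      "\<And>x y. \<bar>G x - G y\<bar> \<le> lG * vec_maxnorm (x - y)" "lG \<ge> 0"
    and f: "\<And>j x. \<bar>f j x\<bar> \<le> 1" "\<And>j x. x \<notin> {1..int N} \<Longrightarrow> f j x = 0"
    and \<rho>: "gowers_ZN M k (f j0) \<le> \<rho>" "0 \<le> \<rho>"
  shows "(\<Prod>i<k. real (card (B i))) * \<bar>\<Sum>n\<in>int_box N. (\<Prod>j\<in>UNIV. f j ((Xi *v n) $ j + r j)) *
      F (int_to_real_vec n) * G (L *v int_to_real_vec n)\<bar>
    \<le> real (card {n \<in> int_box (2 * N). \<forall>l. \<bar>(L *v int_to_real_vec n) $ l\<bar> \<le> \<epsilon> + 1}) *
      (real M ^ k * \<rho> + (\<Prod>i<k. real (card (B i))) * (real k * \<delta> * (lF * real N + lG)))"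
proof -
  define \<Omega> where "\<Omega> = PiE {..<k} B"
  define V where "V = (\<Prod>i<k. real (card (B i)))"
  define \<sigma> where "\<sigma> y = (\<Sum>i<k. w i (y i))" for y
  define P where "P n = (\<Prod>j\<in>UNIV. f j ((Xi *v n) $ j + r j))" for n
  define \<Phi> where "\<Phi> n = F (int_to_real_vec n) * G (L *v int_to_real_vec n)" for n
  define X where "X = {n \<in> int_box (2 * N). \<forall>l. \<bar>(L *v int_to_real_vec n) $ l\<bar> \<le> \<epsilon> + 1}"
  define err where "err = real k * \<delta> * (lF * real N + lG)"
  have cV: "real (card \<Omega>) = V" by (simp add: \<Omega>_def V_def card_PiE)
  have \<Omega>B: "y i \<in> B i" if "y \<in> \<Omega>" "i < k" for y i using that by (auto simp: \<Omega>_def)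
  have \<sigma>1: "\<bar>real_of_int (\<sigma> y $ p)\<bar> \<le> real k * \<delta> * real N" if "y \<in> \<Omega>" for y p
  proof -
    have "\<bar>real_of_int (\<sigma> y $ p)\<bar> \<le> (\<Sum>i<k. \<bar>real_of_int (w i (y i) $ p)\<bar>)"
      unfolding \<sigma>_def by (simp add: sum_abs)
    also have "\<dots> \<le> (\<Sum>i<k. \<delta> * real N)" using that by (intro sum_mono w \<Omega>B) auto
    finally show ?thesis by simp
  qed
  have \<sigma>2: "\<bar>(L *v int_to_real_vec (\<sigma> y)) $ l\<bar> \<le> real k * \<delta>" if "y \<in> \<Omega>" for y l
  proof -
    have "\<bar>(L *v int_to_real_vec (\<sigma> y)) $ l\<bar> \<le> (\<Sum>i<k. \<bar>(L *v int_to_real_vec (w i (y i))) $ l\<bar>)"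
      unfolding \<sigma>_def int_to_real_vec_sum by (simp add: linear_sum[OF matrix_vector_mul_linear] sum_abs)
    also have "\<dots> \<le> (\<Sum>i<k. \<delta>)" using that by (intro sum_mono w \<Omega>B) auto
    finally show ?thesis by simp
  qed
  have X\<sigma>: "(Xi *v \<sigma> y) $ j = (\<Sum>i<k. (Xi *v w i (y i)) $ j)" for y j
    unfolding \<sigma>_def by (simp add: matrix_vector_mult_def sum_distrib_left) (rule sum.swap)
  have \<sigma>3: "\<bar>\<Sum>i<k. (Xi *v w i (y i)) $ j0\<bar> \<le> int N" if "y \<in> \<Omega>" for y
  proof -
    have "\<bar>(int_to_real_mat Xi *v int_to_real_vec (\<sigma> y)) $ j0\<bar> \<le> real CARD('h) * C * (real k * \<delta> * real N)"
      by (rule abs_matrix_vector_component_le[OF Xi(1)]) (simp add: \<sigma>1[OF that])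
    also have "\<dots> = (real CARD('h) * C * (real k * \<delta>)) * real N" by simp
    also have "\<dots> \<le> 1 * real N" by (intro mult_right_mono Xi(2)) simp
    finally show ?thesis unfolding int_to_real_mat_mult X\<sigma> by linarith
  qed
  have \<sigma>box: "\<bar>\<sigma> y $ p\<bar> \<le> int N" if "y \<in> \<Omega>" for y p
  proof -
    have "real k * \<delta> * real N \<le> 1 * real N" by (intro mult_right_mono \<delta>) simp
    then show ?thesis using \<sigma>1[OF that, of p] by linarith
  qed
  have \<Phi>0: "\<Phi> n = 0" if "n \<notin> int_box N" for n
  proof -
    from that have "\<exists>i. \<bar>n $ i\<bar> > int N" by (simp add: int_box_def not_le)
    then obtain i where "\<bar>n $ i\<bar> > int N" ..
    then have "\<bar>real_of_int (n $ i)\<bar> > real N" by linarith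
    then have "F (int_to_real_vec n) = 0" using F(2)[of "int_to_real_vec n"]
      by (metis int_to_real_vec_nth not_le)
    then show ?thesis by (simp add: \<Phi>_def)
  qed
  have P1: "\<bar>P n\<bar> \<le> 1" for n
    unfolding P_def abs_prod using f(1) by (intro prod_le_1) auto
  \<comment> \<open>The box is doubled and the slab widened by \<open>1\<close>, so that one set
    \<open>X\<close> serves all shifts.\<close>
  have shift: "(\<Sum>n\<in>int_box N. P n * \<Phi> n) = (\<Sum>n\<in>X. P (n + \<sigma> y) * \<Phi> (n + \<sigma> y))" if y: "y \<in> \<Omega>" for y
  proof -
    have sub: "int_box N \<subseteq> (\<lambda>n. n + \<sigma> y) ` int_box (2 * N)"
    proof
      fix n :: "int^'h" assume n: "n \<in> int_box N"
      have "\<bar>(n - \<sigma> y) $ p\<bar> \<le> int (2 * N)" for p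
      proof -
        have "\<bar>n $ p\<bar> \<le> int N" using n by (simp add: int_box_def)
        then show ?thesis using \<sigma>box[OF y, of p] by simp
      qed
      then have "n - \<sigma> y \<in> int_box (2 * N)" by (simp add: int_box_def)
      moreover have "n = (n - \<sigma> y) + \<sigma> y" by simp
      ultimately show "n \<in> (\<lambda>n. n + \<sigma> y) ` int_box (2 * N)" by blast
    qed
    have "(\<Sum>n\<in>int_box N. P n * \<Phi> n) = (\<Sum>n\<in>(\<lambda>n. n + \<sigma> y) ` int_box (2 * N). P n * \<Phi> n)"
      by (rule sum.mono_neutral_left) (use sub \<Phi>0 in auto)
    also have "\<dots> = (\<Sum>n\<in>int_box (2 * N). P (n + \<sigma> y) * \<Phi> (n + \<sigma> y))"
      by (subst sum.reindex) (auto simp: inj_on_def)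
    also have "\<dots> = (\<Sum>n\<in>X. P (n + \<sigma> y) * \<Phi> (n + \<sigma> y))"
    proof (rule sum.mono_neutral_right)
      show "\<forall>n\<in>int_box (2 * N) - X. P (n + \<sigma> y) * \<Phi> (n + \<sigma> y) = 0"
      proof
        fix n assume "n \<in> int_box (2 * N) - X"
        then obtain l where "\<bar>(L *v int_to_real_vec n) $ l\<bar> > \<epsilon> + 1" by (auto simp: X_def not_le)
        then have "\<bar>(L *v int_to_real_vec (n + \<sigma> y)) $ l\<bar> > \<epsilon>"
          using \<sigma>2[OF y, of l] \<delta>(2) by (simp add: int_to_real_vec_add matrix_vector_right_distrib)
        then have "G (L *v int_to_real_vec (n + \<sigma> y)) = 0" using G(2) by (metis not_le)
        then show "P (n + \<sigma> y) * \<Phi> (n + \<sigma> y) = 0" by (simp add: \<Phi>_def)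
      qed
    qed (auto simp: X_def)
    finally show ?thesis .
  qed
  have diff: "\<bar>\<Phi> (n + \<sigma> y) - \<Phi> n\<bar> \<le> err" if y: "y \<in> \<Omega>" for n y
  proof -
    let ?x = "int_to_real_vec n" and ?y = "int_to_real_vec (n + \<sigma> y)"
    have "\<bar>F ?y - F ?x\<bar> \<le> lF * vec_maxnorm (?y - ?x)" by (rule F)
    also have "\<dots> \<le> lF * (real k * \<delta> * real N)"
      using \<sigma>1[OF y] by (intro mult_left_mono F vec_maxnorm_le) simp
    finally have 1: "\<bar>F ?y - F ?x\<bar> \<le> lF * (real k * \<delta> * real N)" .
    have "\<bar>G (L *v ?y) - G (L *v ?x)\<bar> \<le> lG * vec_maxnorm (L *v ?y - L *v ?x)" by (rule G)
    also have "\<dots> \<le> lG * (real k * \<delta>)"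
      using \<sigma>2[OF y]
      by (intro mult_left_mono G vec_maxnorm_le) (simp add: int_to_real_vec_add matrix_vector_right_distrib)
    finally have 2: "\<bar>G (L *v ?y) - G (L *v ?x)\<bar> \<le> lG * (real k * \<delta>)" .
    have "\<Phi> (n + \<sigma> y) - \<Phi> n = (F ?y - F ?x) * G (L *v ?y) + F ?x * (G (L *v ?y) - G (L *v ?x))"
      by (simp add: \<Phi>_def algebra_simps)
    then have "\<bar>\<Phi> (n + \<sigma> y) - \<Phi> n\<bar> \<le> \<bar>F ?y - F ?x\<bar> * \<bar>G (L *v ?y)\<bar> + \<bar>F ?x\<bar> * \<bar>G (L *v ?y) - G (L *v ?x)\<bar>"
      by (metis abs_mult abs_triangle_ineq)
    also have "\<dots> \<le> \<bar>F ?y - F ?x\<bar> * 1 + 1 * \<bar>G (L *v ?y) - G (L *v ?x)\<bar>"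
      using F(1) G(1) by (intro add_mono mult_mono) auto
    also have "\<dots> \<le> err" using 1 2 by (simp add: err_def algebra_simps)
    finally show ?thesis .
  qed
  have inner: "\<bar>\<Sum>y\<in>\<Omega>. P (n + \<sigma> y)\<bar> \<le> real M ^ k * \<rho>" for n
  proof -
    have "P (n + \<sigma> y) = (\<Prod>j\<in>UNIV. f j (((Xi *v n) $ j + r j) + (\<Sum>i<k. (Xi *v w i (y i)) $ j)))" for y
      unfolding P_def matrix_vector_right_distrib by (simp add: X\<sigma> add_ac)
    then show ?thesis
      using abs_section_sum_le[OF k e M B, where \<tau> = "\<lambda>j i y. (Xi *v w i y) $ j" and f = f
            and \<rho> = \<rho> and a = "\<lambda>j. (Xi *v n) $ j + r j"]
        w \<sigma>3 f \<rho> by (simp add: \<Omega>_def)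
  qed
  have nX: "\<bar>\<Sum>y\<in>\<Omega>. P (n + \<sigma> y) * \<Phi> (n + \<sigma> y)\<bar> \<le> real M ^ k * \<rho> + V * err" for n
  proof -
    \<comment> \<open>Freezing \<open>\<Phi>\<close> at \<open>n\<close> leaves the pure product
      \<open>P\<close>, to which \<open>inner\<close> applies.\<close>
    have "(\<Sum>y\<in>\<Omega>. P (n + \<sigma> y) * \<Phi> (n + \<sigma> y))
        = \<Phi> n * (\<Sum>y\<in>\<Omega>. P (n + \<sigma> y)) + (\<Sum>y\<in>\<Omega>. P (n + \<sigma> y) * (\<Phi> (n + \<sigma> y) - \<Phi> n))"
      by (simp add: sum_distrib_left algebra_simps flip: sum.distrib)
    also have "\<bar>\<dots>\<bar> \<le> \<bar>\<Phi> n\<bar> * \<bar>\<Sum>y\<in>\<Omega>. P (n + \<sigma> y)\<bar> + (\<Sum>y\<in>\<Omega>. \<bar>P (n + \<sigma> y)\<bar> * \<bar>\<Phi> (n + \<sigma> y) - \<Phi> n\<bar>)"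
      unfolding abs_mult[symmetric] by (intro order.trans[OF abs_triangle_ineq] add_mono sum_abs) auto
    also have "\<dots> \<le> 1 * (real M ^ k * \<rho>) + (\<Sum>y\<in>\<Omega>. 1 * err)"
      using F(1) G(1)
      by (intro add_mono mult_mono sum_mono inner P1 diff) (auto simp: \<Phi>_def abs_mult intro!: mult_le_one)
    finally show ?thesis by (simp add: cV)
  qed
  have "V * (\<Sum>n\<in>int_box N. P n * \<Phi> n) = (\<Sum>y\<in>\<Omega>. \<Sum>n\<in>X. P (n + \<sigma> y) * \<Phi> (n + \<sigma> y))"
    by (simp add: shift[symmetric] cV)
  also have "\<dots> = (\<Sum>n\<in>X. \<Sum>y\<in>\<Omega>. P (n + \<sigma> y) * \<Phi> (n + \<sigma> y))" by (rule sum.swap)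
  also have "\<bar>\<dots>\<bar> \<le> (\<Sum>n\<in>X. real M ^ k * \<rho> + V * err)"
    by (intro order.trans[OF sum_abs] sum_mono nX)
  finally have "\<bar>V * (\<Sum>n\<in>int_box N. P n * \<Phi> n)\<bar> \<le> real (card X) * (real M ^ k * \<rho> + V * err)" by simp
  moreover have "V \<ge> 0" by (simp add: V_def prod_nonneg)
  ultimately show ?thesis
    unfolding V_def[symmetric] X_def[symmetric] err_def[symmetric]
    by (simp add: abs_mult P_def \<Phi>_def mult.assoc)
qed

section \<open>Choice of scale and the final bound\<close>

text \<open>For \<open>\<delta> = \<rho> powr a\<close> the number of shifts is at least a constant
  times \<open>\<delta> ^ p * real N ^ k\<close> with \<open>p = (CARD('m) + 1) * k\<close>. The
  Gowers term is then a constant times at most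
  \<open>\<rho> / \<delta> ^ p = \<rho> powr (3 / 4)\<close>, hence at most a constant times
  \<delta>, like the smoothing error up to the factor
  \<open>1 / \<sigma>F + 1 / \<sigma>G\<close>.\<close>

lemma T_op_le_gowers:
  fixes c C \<epsilon> AF AG :: real
  assumes c: "c > 0" and C: "C > 0" and eps: "\<epsilon> > 0"
    and mh: "CARD('m) \<le> CARD('h)" and k: "CARD('d) = k + 1" "k \<ge> 2"
  obtains K where "K \<ge> 0"
    "\<And>N (Xi::int^'h^'d) (L::real^'h^'m) \<sigma>F \<sigma>G F G r f j0 \<rho>.
      N > 0 \<Longrightarrow> mat_maxnorm (int_to_real_mat Xi) \<le> C \<Longrightarrow> mat_maxnorm L \<le> C \<Longrightarrow>
      dist_rank_ge L c \<Longrightarrow> dist_degen_ge (int_to_real_mat Xi) L c \<Longrightarrow>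
      0 < \<sigma>F \<Longrightarrow> \<sigma>F \<le> 1 \<Longrightarrow> 0 < \<sigma>G \<Longrightarrow>
      (\<And>x. 0 \<le> F x \<and> F x \<le> 1) \<Longrightarrow> (\<And>x. F x \<noteq> 0 \<Longrightarrow> \<forall>i. \<bar>x $ i\<bar> \<le> real N) \<Longrightarrow>
      (\<And>x y. \<bar>F x - F y\<bar> \<le> AF / (\<sigma>F * real N) * vec_maxnorm (x - y)) \<Longrightarrow>
      (\<And>x. 0 \<le> G x \<and> G x \<le> 1) \<Longrightarrow> (\<And>x. G x \<noteq> 0 \<Longrightarrow> \<forall>i. \<bar>x $ i\<bar> \<le> \<epsilon>) \<Longrightarrow>
      (\<And>x y. \<bar>G x - G y\<bar> \<le> AG / \<sigma>G * vec_maxnorm (x - y)) \<Longrightarrow>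
      (\<And>j x. \<bar>f j x\<bar> \<le> 1) \<Longrightarrow> (\<And>j x. x \<notin> {1..int N} \<Longrightarrow> f j x = 0) \<Longrightarrow>
      0 < \<rho> \<Longrightarrow> \<rho> \<le> 1 \<Longrightarrow> gowers_interval k N (f j0) \<le> \<rho> \<Longrightarrow>
      \<bar>T_op L Xi r F G N f\<bar> \<le> K * (\<rho> powr (1 / (4 * (real CARD('m) + 1) * real k)) * (1 / \<sigma>F + 1 / \<sigma>G))"
proof -
  define a where "a = 1 / (4 * (real CARD('m) + 1) * real k)"
  define H where "H = real CARD('h) * C"
  have H: "H > 0" using C by (simp add: H_def)
  have k0: "real k \<ge> 2" using k(2) by simp
  \<comment> \<open>The first bound gives \<open>\<rho> \<le> \<delta> ^ (4 * k)\<close>, which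
    keeps \<open>\<delta> * real N\<close> large; the second makes the loss in the number of shifts
    equal to \<open>\<rho> powr (1 / 4)\<close>.\<close>
  have ak: "a * real (4 * k) \<le> 1" "a * real ((CARD('m) + 1) * k) = 1 / 4" "a > 0"
    using k0 by (simp_all add: a_def divide_simps) (simp_all add: algebra_simps)
  have a8: "a \<le> 1 / 8"
  proof -
    have "a * 8 \<le> a * real (4 * k)" using ak(3) k0 by (intro mult_left_mono) auto
    then show ?thesis using ak(1) by simp
  qed
  obtain K1 where K1: "K1 > 0" "\<And>(L::real^'h^'m) N. mat_maxnorm L \<le> C \<Longrightarrow> dist_rank_ge L c \<Longrightarrow> N > 0 \<Longrightarrow>
    real (card {n \<in> int_box (2 * N). \<forall>l. \<bar>(L *v int_to_real_vec n) $ l\<bar> \<le> \<epsilon> + 1})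
      \<le> K1 * real N ^ (CARD('h) - CARD('m))"
    by (rule card_small_image_le[OF c C _ mh, of "\<epsilon> + 1"]) (use eps in auto)
  obtain \<kappa> R where \<kappa>: "\<kappa> > 0" "R > 0"
    "\<And>(Xi::int^'h^'d) (L::real^'h^'m) j j0 \<delta> N M.
      mat_maxnorm (int_to_real_mat Xi) \<le> C \<Longrightarrow> mat_maxnorm L \<le> C \<Longrightarrow>
      dist_degen_ge (int_to_real_mat Xi) L c \<Longrightarrow> j \<noteq> j0 \<Longrightarrow> 0 < \<delta> \<Longrightarrow> \<delta> \<le> 1 \<Longrightarrow>
      real CARD('h) * C * \<delta> \<le> 1 \<Longrightarrow> R \<le> \<delta> * real N \<Longrightarrow> 2 * N < M \<Longrightarrow>
      \<exists>B w. B \<subseteq> {0..<int M} \<and> \<kappa> * \<delta> ^ (CARD('m) + 1) * real N \<le> real (card B) \<and>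
        (\<forall>y\<in>B. (Xi *v w y) $ j0 mod int M = y \<and> (Xi *v w y) $ j = 0 \<and>
          (\<forall>i. \<bar>real_of_int (w y $ i)\<bar> \<le> \<delta> * real N) \<and>
          (\<forall>l. \<bar>(L *v int_to_real_vec (w y)) $ l\<bar> \<le> \<delta>))"
    by (rule exists_shift_section[OF c C]) blast
  \<comment> \<open>For \<open>\<delta> \<le> \<delta>0\<close> these bounds give
    \<open>real k * \<delta> \<le> 1\<close>, \<open>H * (real k * \<delta>) \<le> 1\<close> and
    \<open>R \<le> 1 / \<delta>\<close>.\<close>
  define \<delta>0 where "\<delta>0 = min (1 / real k) (min (1 / (H * real k)) (1 / R))"
  have \<delta>0: "\<delta>0 > 0" "\<delta>0 \<le> 1 / real k" "\<delta>0 \<le> 1 / (H * real k)" "\<delta>0 \<le> 1 / R"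
    using k0 H \<kappa> by (auto simp: \<delta>0_def)
  define K2 where "K2 = (2 ^ (k + 1) / \<kappa>) ^ k"
  define K3 where "K3 = real ((2 ^ (k + 1)) ^ k)"
  define K4 where "K4 = real k * (\<bar>AF\<bar> + \<bar>AG\<bar>)"
  have Kpos: "K2 \<ge> 0" "K3 \<ge> 0" "K4 \<ge> 0" using \<kappa> by (simp_all add: K2_def K3_def K4_def)
  \<comment> \<open>\<open>1 / \<delta>0\<close> serves large \<rho>, \<open>K3\<close> tiny \<rho>,
    and \<open>K2 + K4\<close> the main range.\<close>
  define K where "K = K1 * (1 / \<delta>0 + K2 + K3 + K4)"
  have main: "\<bar>T_op L Xi r F G N f\<bar> \<le> K * (\<rho> powr a * (1 / \<sigma>F + 1 / \<sigma>G))"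
    if N: "N > 0" and Xi: "mat_maxnorm (int_to_real_mat Xi) \<le> C" and L: "mat_maxnorm L \<le> C"
      "dist_rank_ge L c" and nd: "dist_degen_ge (int_to_real_mat Xi) L c"
      and \<sigma>: "0 < \<sigma>F" "\<sigma>F \<le> 1" "0 < \<sigma>G"
      and F: "\<And>x. 0 \<le> F x \<and> F x \<le> 1" "\<And>x. F x \<noteq> 0 \<Longrightarrow> \<forall>i. \<bar>x $ i\<bar> \<le> real N"
        "\<And>x y. \<bar>F x - F y\<bar> \<le> AF / (\<sigma>F * real N) * vec_maxnorm (x - y)"
      and G: "\<And>x. 0 \<le> G x \<and> G x \<le> 1" "\<And>x. G x \<noteq> 0 \<Longrightarrow> \<forall>i. \<bar>x $ i\<bar> \<le> \<epsilon>"
        "\<And>x y. \<bar>G x - G y\<bar> \<le> AG / \<sigma>G * vec_maxnorm (x - y)"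
      and f: "\<And>j x. \<bar>f j x\<bar> \<le> 1" "\<And>j x. x \<notin> {1..int N} \<Longrightarrow> f j x = 0"
      and \<rho>: "0 < \<rho>" "\<rho> \<le> 1" "gowers_interval k N (f j0) \<le> \<rho>"
    for N and Xi :: "int^'h^'d" and L :: "real^'h^'m" and \<sigma>F \<sigma>G F G r f j0 \<rho>
  proof -
    define M where "M = gowers_modulus k N"
    define s where "s = (\<Sum>n\<in>int_box N. (\<Prod>j\<in>UNIV. f j ((Xi *v n) $ j + r j)) *
      F (int_to_real_vec n) * G (L *v int_to_real_vec n))"
    define X where "X = {n \<in> int_box (2 * N). \<forall>l. \<bar>(L *v int_to_real_vec n) $ l\<bar> \<le> \<epsilon> + 1}"
    define q where "q = real N ^ (CARD('h) - CARD('m))"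
    define g where "g = 1 / \<sigma>F + 1 / \<sigma>G"
    have q0: "q > 0" using N by (simp add: q_def)
    have T: "\<bar>T_op L Xi r F G N f\<bar> = \<bar>s\<bar> / q"
      using q0 by (simp add: T_op_def s_def q_def int_box_def abs_mult)
    have cX: "real (card X) \<le> K1 * q" unfolding X_def q_def by (rule K1(2)[OF L N])
    have g1: "g \<ge> 1"
    proof -
      have "1 \<le> 1 / \<sigma>F" "0 \<le> 1 / \<sigma>G" using \<sigma> by (simp_all add: divide_simps)
      then show ?thesis unfolding g_def by linarith
    qed
    have Mk: "real M ^ k = K3 * real N ^ k"
      by (simp add: M_def gowers_modulus_def K3_def power_mult_distrib)
    have M4: "4 * N < M" and M2: "2 * N < M"
    proof -
      have "(2::nat) ^ 3 \<le> 2 ^ (k + 1)" using k(2) by (intro power_increasing) auto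
      then have "8 * N \<le> M" unfolding M_def gowers_modulus_def by (intro mult_right_mono) auto
      then show "4 * N < M" "2 * N < M" using N by auto
    qed
    have "(\<lambda>x. if x \<in> {1..int N} then f j0 x else 0) = f j0" using f(2) by (auto simp: fun_eq_iff)
    then have gow: "gowers_ZN M k (f j0) \<le> \<rho>"
      using gowers_ZN_le_of_interval[OF N \<rho>(3)] \<rho>(1) by (simp add: M_def)
    obtain e where e: "bij_betw e {..<k} (UNIV - {j0})"
      using ex_bij_betw_nat_finite[of "UNIV - {j0}"] k(1)
      by (auto simp: card_Diff_singleton atLeast0LessThan)
    have F': "\<bar>F x - F y\<bar> \<le> \<bar>AF\<bar> / (\<sigma>F * real N) * vec_maxnorm (x - y)" for x y
      by (rule order.trans[OF F(3)], rule mult_right_mono[OF _ vec_maxnorm_nonneg])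
        (use \<sigma> in \<open>auto intro!: divide_right_mono\<close>)
    have G': "\<bar>G x - G y\<bar> \<le> \<bar>AG\<bar> / \<sigma>G * vec_maxnorm (x - y)" for x y
      by (rule order.trans[OF G(3)], rule mult_right_mono[OF _ vec_maxnorm_nonneg])
        (use \<sigma> in \<open>auto intro!: divide_right_mono\<close>)
    \<comment> \<open>Stated for any admissible system of shifts: it is used once with zero shifts
      and once with those of \<open>exists_shift_section\<close>.\<close>
    have core: "\<bar>T_op L Xi r F G N f\<bar> \<le> K1 * (real M ^ k * \<rho> / V + \<delta> * K4 * g)"
      if B: "\<And>i. i < k \<Longrightarrow> B i \<subseteq> {0..<int M}"
        and w: "\<And>i y. i < k \<Longrightarrow> y \<in> B i \<Longrightarrow> (Xi *v w i y) $ j0 mod int M = y"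
          "\<And>i y. i < k \<Longrightarrow> y \<in> B i \<Longrightarrow> (Xi *v w i y) $ e i = 0"
          "\<And>i y p. i < k \<Longrightarrow> y \<in> B i \<Longrightarrow> \<bar>real_of_int (w i y $ p)\<bar> \<le> \<delta> * real N"
          "\<And>i y l. i < k \<Longrightarrow> y \<in> B i \<Longrightarrow> \<bar>(L *v int_to_real_vec (w i y)) $ l\<bar> \<le> \<delta>"
        and \<delta>: "0 \<le> \<delta>" "\<delta> \<le> \<delta>0" and V: "V = (\<Prod>i<k. real (card (B i)))" "V > 0"
      for B w \<delta> V
    proof -
      have k\<delta>: "real k * \<delta> \<le> real k * \<delta>0" using \<delta>(2) by (intro mult_left_mono) auto
      have "real k * \<delta>0 \<le> 1" "H * (real k * \<delta>0) \<le> 1"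
        using \<delta>0(2,3) k0 H by (simp_all add: field_simps)
      moreover have "H * (real k * \<delta>) \<le> H * (real k * \<delta>0)" using H by (intro mult_left_mono k\<delta>) simp
      ultimately have \<delta>1: "real k * \<delta> \<le> 1" "real CARD('h) * C * (real k * \<delta>) \<le> 1"
        using k\<delta> unfolding H_def by linarith+
      have lg: "\<bar>AF\<bar> / (\<sigma>F * real N) \<ge> 0" "\<bar>AG\<bar> / \<sigma>G \<ge> 0" using \<sigma> by auto
      have "V * \<bar>s\<bar> \<le> real (card X) * (real M ^ k * \<rho> +
          V * (real k * \<delta> * (\<bar>AF\<bar> / (\<sigma>F * real N) * real N + \<bar>AG\<bar> / \<sigma>G)))"
        unfolding V(1) s_def X_def
        by (rule abs_weighted_count_le[where e = e and M = M and N = N and B = B and w = w and \<delta> = \<delta>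
              and C = C and F = F and G = G and f = f and L = L and Xi = Xi, OF k(2) e M4 B w \<delta>(1) \<delta>1(1) Xi \<delta>1(2) F(1,2) F' lg(1) G(1,2) G' lg(2) f gow])
          (use \<rho> in auto)
      also have "\<dots> \<le> (K1 * q) * (real M ^ k * \<rho> + V * (\<delta> * K4 * g))"
      proof (rule mult_mono[OF cX add_left_mono[OF mult_left_mono]])
        have "\<bar>AF\<bar> / (\<sigma>F * real N) * real N = \<bar>AF\<bar> * (1 / \<sigma>F)" using N by simp
        also have "\<dots> \<le> \<bar>AF\<bar> * g" using \<sigma> by (intro mult_left_mono) (auto simp: g_def)
        finally have 1: "\<bar>AF\<bar> / (\<sigma>F * real N) * real N \<le> \<bar>AF\<bar> * g" .
        have "\<bar>AG\<bar> / \<sigma>G = \<bar>AG\<bar> * (1 / \<sigma>G)" by simp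
        also have "\<dots> \<le> \<bar>AG\<bar> * g" using \<sigma> by (intro mult_left_mono) (auto simp: g_def)
        finally have 2: "\<bar>AG\<bar> / \<sigma>G \<le> \<bar>AG\<bar> * g" .
        have "real k * \<delta> * (\<bar>AF\<bar> / (\<sigma>F * real N) * real N + \<bar>AG\<bar> / \<sigma>G)
            \<le> real k * \<delta> * (\<bar>AF\<bar> * g + \<bar>AG\<bar> * g)"
          using \<delta>(1) by (intro mult_left_mono add_mono 1 2) auto
        then show "real k * \<delta> * (\<bar>AF\<bar> / (\<sigma>F * real N) * real N + \<bar>AG\<bar> / \<sigma>G) \<le> \<delta> * K4 * g"
          by (simp add: K4_def algebra_simps)
        show "0 \<le> real M ^ k * \<rho> + V * (real k * \<delta> * (\<bar>AF\<bar> / (\<sigma>F * real N) * real N + \<bar>AG\<bar> / \<sigma>G))"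
          using lg V(2) \<delta>(1) \<rho>(1) by (intro add_nonneg_nonneg mult_nonneg_nonneg) auto
      qed (use K1 q0 V in auto)
      finally have "\<bar>s\<bar> / q \<le> K1 * (real M ^ k * \<rho> / V + \<delta> * K4 * g)"
        using V(2) q0 by (simp add: field_simps)
      then show ?thesis unfolding T .
    qed
    have fin: ?thesis if "\<bar>T_op L Xi r F G N f\<bar> \<le> K1 * (A * \<rho> powr a * g)" "A \<le> 1 / \<delta>0 + K2 + K3 + K4" for A
    proof -
      have "K1 * (A * \<rho> powr a * g) \<le> K1 * ((1 / \<delta>0 + K2 + K3 + K4) * \<rho> powr a * g)"
        using that(2) K1 g1 by (intro mult_left_mono mult_right_mono) auto
      then show ?thesis using that(1) by (simp add: K_def g_def mult.assoc)
    qed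
    have pa: "\<rho> powr a > 0" "\<rho> powr a \<le> 1" using \<rho> ak by (auto intro: powr_le1)
    have mono: "\<rho> powr y \<le> \<rho> powr x" if "x \<le> y" for x y
      using \<rho> that by (intro powr_mono') auto
    consider "real N ^ (2 * k) * \<rho> \<le> 1" | "\<rho> powr a > \<delta>0" | "real N ^ (2 * k) * \<rho> > 1" "\<rho> powr a \<le> \<delta>0"
      by linarith
    then show ?thesis
    proof cases
      case 1
      \<comment> \<open>Only zero shifts: \<open>V = 1\<close> and there is no smoothing error, so
        \<open>real N ^ k * \<rho> \<le> sqrt \<rho>\<close> decides.\<close>
      have "\<bar>T_op L Xi r F G N f\<bar> \<le> K1 * (real M ^ k * \<rho> / 1 + 0 * K4 * g)"
        by (rule core[of "\<lambda>_. {0}" "\<lambda>_ _. 0"])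
          (use M4 \<delta>0 in \<open>auto simp: int_to_real_vec_def matrix_vector_mult_def\<close>)
      also have "\<dots> = K1 * (K3 * (real N ^ k * \<rho>))" by (simp add: Mk)
      also have "\<dots> \<le> K1 * (K3 * (\<rho> powr a * g))"
      proof (intro mult_left_mono)
        have "(real N ^ k * \<rho>)\<^sup>2 = (real N ^ (2 * k) * \<rho>) * \<rho>"
          by (simp add: power2_eq_square power_mult power_mult_distrib mult_ac)
        also have "\<dots> \<le> 1 * \<rho>" using 1 \<rho> by (intro mult_right_mono) auto
        finally have "real N ^ k * \<rho> \<le> sqrt \<rho>" by (intro real_le_rsqrt) simp
        also have "\<dots> = \<rho> powr (1 / 2)" using \<rho> by (simp add: powr_half_sqrt)
        also have "\<dots> \<le> \<rho> powr a" by (rule mono) (use a8 in simp)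
        also have "\<dots> \<le> \<rho> powr a * g" using pa g1 by simp
        finally show "real N ^ k * \<rho> \<le> \<rho> powr a * g" .
      qed (use K1 Kpos in auto)
      finally show ?thesis by (intro fin[of K3]) (use Kpos \<delta>0 in \<open>auto simp: mult.assoc\<close>)
    next
      case 2
      \<comment> \<open>Here \<open>\<rho> powr a\<close> is bounded below, so counting the points
        of \<open>X\<close> is enough.\<close>
      have "\<bar>s\<bar> \<le> (\<Sum>n\<in>int_box N. if n \<in> X then 1 else 0)"
        unfolding s_def
      proof (rule order.trans[OF sum_abs sum_mono])
        fix n :: "int^'h" assume n: "n \<in> int_box N"
        let ?t = "(\<Prod>j\<in>UNIV. f j ((Xi *v n) $ j + r j)) * F (int_to_real_vec n) * G (L *v int_to_real_vec n)"
        have "\<bar>\<Prod>j\<in>UNIV. f j ((Xi *v n) $ j + r j)\<bar> \<le> 1"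
          unfolding abs_prod using f(1) by (intro prod_le_1) auto
        then have "\<bar>?t\<bar> \<le> 1" unfolding abs_mult using F(1) G(1) by (intro mult_le_one) auto
        moreover have "?t = 0" if "n \<notin> X"
        proof -
          have "n \<in> int_box (2 * N)" using n by (auto simp: int_box_def intro: order.trans[of _ "int N"])
          then obtain l where "\<bar>(L *v int_to_real_vec n) $ l\<bar> > \<epsilon> + 1"
            using \<open>n \<notin> X\<close> by (auto simp: X_def not_le)
          then have "\<not> (\<bar>(L *v int_to_real_vec n) $ l\<bar> \<le> \<epsilon>)" by simp
          then have "G (L *v int_to_real_vec n) = 0" using G(2) by metis
          then show ?thesis by simp
        qed
        ultimately show "\<bar>?t\<bar> \<le> (if n \<in> X then 1 else 0)" by auto
      qed
      also have "\<dots> \<le> real (card X)"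
      proof -
        have "finite X" by (simp add: X_def)
        then show ?thesis by (simp flip: sum.inter_restrict) (simp add: card_mono)
      qed
      finally have "\<bar>T_op L Xi r F G N f\<bar> \<le> K1"
        using cX q0 unfolding T by (simp add: divide_simps)
      also have "\<dots> = K1 * (1 / \<delta>0 * \<delta>0 * 1)" using \<delta>0(1) by simp
      also have "\<dots> \<le> K1 * (1 / \<delta>0 * \<rho> powr a * g)"
        using 2 K1 \<delta>0(1) g1 by (intro mult_left_mono mult_mono) auto
      finally show ?thesis by (intro fin[of "1 / \<delta>0"]) (use Kpos in auto)
    next
      case 3
      define \<delta> where "\<delta> = \<rho> powr a"
      define p where "p = (CARD('m) + 1) * k"
      have \<delta>: "0 < \<delta>" "\<delta> \<le> 1" "\<delta> \<le> \<delta>0" using pa 3 by (auto simp: \<delta>_def)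
      have \<delta>pow: "\<delta> ^ n = \<rho> powr (a * real n)" for n
        using \<rho> by (simp add: \<delta>_def powr_powr flip: powr_realpow)
      \<comment> \<open>Otherwise the power \<open>2 * k\<close> of the left side is at most
        \<open>1\<close>, and \<open>\<rho> \<le> \<delta> ^ (4 * k)\<close> gives
        \<open>\<rho> * real N ^ (2 * k) \<le> 1\<close>, against the case assumption.\<close>
      have "\<delta>\<^sup>2 * real N \<ge> 1"
      proof (rule ccontr)
        assume "\<not> \<delta>\<^sup>2 * real N \<ge> 1"
        then have "(\<delta>\<^sup>2 * real N) ^ (2 * k) \<le> 1" by (intro power_le_one) auto
        moreover have "(\<delta>\<^sup>2 * real N) ^ (2 * k) = \<delta> ^ (4 * k) * real N ^ (2 * k)"
          by (simp add: power_mult_distrib flip: power_mult)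
        moreover have "\<rho> powr 1 \<le> \<delta> ^ (4 * k)" unfolding \<delta>pow by (intro mono ak)
        then have "\<rho> * real N ^ (2 * k) \<le> \<delta> ^ (4 * k) * real N ^ (2 * k)"
          using \<rho> by (intro mult_right_mono) auto
        ultimately show False using 3(1) by (simp add: mult.commute)
      qed
      then have "1 / \<delta> \<le> \<delta> * real N" using \<delta> by (simp add: divide_simps power2_eq_square mult_ac)
      moreover have "R \<le> 1 / \<delta>"
        using \<delta> \<delta>0(4) \<kappa>(2) by (smt (verit) le_divide_eq mult.commute)
      ultimately have R: "R \<le> \<delta> * real N" by linarith
      have H\<delta>: "real CARD('h) * C * \<delta> \<le> 1"
      proof -
        have "H * \<delta> \<le> H * (1 / (H * real k))" using H \<delta>(3) \<delta>0(3) by (intro mult_left_mono) auto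
        also have "\<dots> \<le> 1" using H k0 by simp
        finally show ?thesis by (simp add: H_def)
      qed
      have ei: "e i \<noteq> j0" if "i < k" for i using e that by (auto simp: bij_betw_def)
      define good where "good i B w \<longleftrightarrow> B \<subseteq> {0..<int M} \<and> \<kappa> * \<delta> ^ (CARD('m) + 1) * real N \<le> real (card B) \<and>
        (\<forall>y\<in>B. (Xi *v w y) $ j0 mod int M = y \<and> (Xi *v w y) $ e i = 0 \<and>
          (\<forall>p. \<bar>real_of_int (w y $ p)\<bar> \<le> \<delta> * real N) \<and>
          (\<forall>l. \<bar>(L *v int_to_real_vec (w y)) $ l\<bar> \<le> \<delta>))" for i B and w :: "int \<Rightarrow> int^'h"
      have "\<exists>B w. good i B w" if "i < k" for i
        unfolding good_def by (rule \<kappa>(3)[OF Xi L(1) nd ei[OF that] \<delta>(1,2) H\<delta> R M2])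
      then obtain B w where "\<And>i. i < k \<Longrightarrow> good i (B i) (w i)" by metis
      note Bw = this[unfolded good_def]
      define V where "V = (\<Prod>i<k. real (card (B i)))"
      define V0 where "V0 = \<kappa> ^ k * \<delta> ^ p * real N ^ k"
      have V00: "V0 > 0" using \<kappa> \<delta> N by (simp add: V0_def)
      have "(\<Prod>i<k. \<kappa> * \<delta> ^ (CARD('m) + 1) * real N) \<le> V"
        unfolding V_def using Bw \<kappa> \<delta> by (intro prod_mono) auto
      moreover have "(\<Prod>i<k. \<kappa> * \<delta> ^ (CARD('m) + 1) * real N) = V0"
        by (simp only: prod_constant card_lessThan power_mult_distrib V0_def p_def flip: power_mult)
      ultimately have V0: "V0 \<le> V" by simp
      have "\<bar>T_op L Xi r F G N f\<bar> \<le> K1 * (real M ^ k * \<rho> / V + \<delta> * K4 * g)"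
        by (rule core[of B w]) (use Bw \<delta> V0 V00 in \<open>auto simp: V_def\<close>)
      also have "\<dots> \<le> K1 * (K2 * \<delta> * g + \<delta> * K4 * g)"
      proof (intro mult_left_mono add_right_mono)
        \<comment> \<open>\<open>\<delta> ^ p\<close> is \<open>\<rho> powr (1 / 4)\<close>, and the
          remaining exponent \<open>3 / 4\<close> pays for one factor \<delta>, since
          \<open>a \<le> 1 / 8\<close>.\<close>
        have "\<rho> = \<rho> powr (1 / 4) * \<rho> powr (3 / 4)" using \<rho> by (simp flip: powr_add)
        also have "\<dots> \<le> \<delta> ^ p * \<rho> powr a"
          unfolding \<delta>pow p_def ak using a8 by (intro mult_left_mono mono) auto
        finally have "\<rho> \<le> \<delta> ^ p * \<delta>" by (simp add: \<delta>_def)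
        then have "real M ^ k * \<rho> / V \<le> real M ^ k * (\<delta> ^ p * \<delta>) / V0"
          using V0 V00 \<rho> by (intro frac_le mult_left_mono) auto
        also have "\<dots> = K2 * \<delta>"
          using N \<kappa> \<delta> by (simp add: V0_def Mk K2_def K3_def power_divide)
        also have "\<dots> \<le> K2 * \<delta> * g"
        proof -
          have "K2 * \<delta> * 1 \<le> K2 * \<delta> * g" using Kpos \<delta> g1 by (intro mult_left_mono) auto
          then show ?thesis by simp
        qed
        finally show "real M ^ k * \<rho> / V \<le> K2 * \<delta> * g" .
      qed (use K1 in simp)
      also have "\<dots> = K1 * ((K2 + K4) * \<rho> powr a * g)" by (simp add: \<delta>_def algebra_simps)
      finally show ?thesis by (intro fin[of "K2 + K4"]) (use Kpos \<delta>0 in auto)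
    qed
  qed
  have "K \<ge> 0" using K1 Kpos \<delta>0 by (simp add: K_def)
  then show thesis by (rule that) (rule main[unfolded a_def])
qed

theorem theorem4p6:
  assumes dims: "CARD('d) \<ge> CARD('h)" "CARD('h) \<ge> CARD('m) + 2"
  shows "\<exists>a1 a2 b1 b2 :: real. a1 > 0 \<and> a2 > 0 \<and>
    (\<forall>c C :: real. c > 0 \<longrightarrow> C > 0 \<longrightarrow>
     (\<exists>S :: int^'h^'d \<Rightarrow> real^'h^'m \<Rightarrow> nat.
      \<forall>\<epsilon> AF AG Ar :: real. \<epsilon> > 0 \<longrightarrow>
       (\<exists>K :: real. \<forall>(N::nat) (Xi::int^'h^'d) (L::real^'h^'m).
         inj ((*v) (int_to_real_mat Xi)) \<and>
         (*v) (int_to_real_mat Xi) ` int_lattice =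
            int_lattice \<inter> range ((*v) (int_to_real_mat Xi)) \<and>
         surj ((*v) L) \<and>
         mat_maxnorm (int_to_real_mat Xi) \<le> C \<and> mat_maxnorm L \<le> C \<and>
         dist_rank_ge L c \<and> dist_degen_ge (int_to_real_mat Xi) L c
         \<longrightarrow>
         S Xi L \<le> CARD('d) - 2 \<and>
         (\<forall>(\<sigma>F::real) (\<sigma>G::real) (F::real^'h \<Rightarrow> real) (G::real^'m \<Rightarrow> real)
             (r::'d \<Rightarrow> int) (f::'d \<Rightarrow> int \<Rightarrow> real) (\<rho>::real).
           0 < \<sigma>F \<and> \<sigma>F < 1/2 \<and> 0 < \<sigma>G \<and> \<sigma>G < 1/2 \<and>
           (\<forall>x. 0 \<le> F x \<and> F x \<le> 1) \<and>
           (\<forall>x. F x \<noteq> 0 \<longrightarrow> (\<forall>i. \<bar>x $ i\<bar> \<le> real N)) \<and>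
           (\<forall>x y. \<bar>F x - F y\<bar> \<le> AF / (\<sigma>F * real N) * vec_maxnorm (x - y)) \<and>
           (\<forall>x. 0 \<le> G x \<and> G x \<le> 1) \<and>
           (\<forall>x. G x \<noteq> 0 \<longrightarrow> (\<forall>i. \<bar>x $ i\<bar> \<le> \<epsilon>)) \<and>
           (\<forall>x y. \<bar>G x - G y\<bar> \<le> AG / \<sigma>G * vec_maxnorm (x - y)) \<and>
           (\<forall>j. \<bar>real_of_int (r j)\<bar> \<le> Ar) \<and>
           (\<forall>j x. - 1 \<le> f j x \<and> f j x \<le> 1) \<and>
           (\<forall>j x. x \<notin> {1..int N} \<longrightarrow> f j x = 0) \<and>
           0 < \<rho> \<and> \<rho> \<le> 1 \<and>
           Min (range (\<lambda>j. gowers_interval (S Xi L + 1) N (f j))) \<le> \<rho>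
           \<longrightarrow>
           \<bar>T_op L Xi r F G N f\<bar> \<le>
             K * (\<rho> powr a1 * (\<sigma>F powr (- b1) + \<sigma>G powr (- b2))
                  + \<sigma>F powr (- b1) * real N powr (- a2))))))"
proof -
  \<comment> \<open>\<open>k\<close> is both the degree \<open>s + 1\<close> of the Gowers norm for
    \<open>s = CARD('d) - 2\<close> and the number of indices other than \<open>j0\<close>. The
    dimension hypotheses give \<open>CARD('d) \<ge> 3\<close>, hence
    \<open>k \<ge> 2\<close>.\<close>
  define k where "k = CARD('d) - 1"
  have m1: "CARD('m) \<ge> 1" by (simp add: Suc_leI)
  then have k: "CARD('d) = k + 1" "k \<ge> 2" "CARD('m) \<le> CARD('h)"
    using dims unfolding k_def by linarith+
  have Sk: "CARD('d) - 2 + 1 = k" using k by simp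
  define a where "a = 1 / (4 * (real CARD('m) + 1) * real k)"
  have a0: "a > 0" using k(2) by (simp add: a_def)
  have main: "\<exists>K :: real. \<forall>(N::nat) (Xi::int^'h^'d) (L::real^'h^'m).
         inj ((*v) (int_to_real_mat Xi)) \<and>
         (*v) (int_to_real_mat Xi) ` int_lattice =
            int_lattice \<inter> range ((*v) (int_to_real_mat Xi)) \<and>
         surj ((*v) L) \<and>
         mat_maxnorm (int_to_real_mat Xi) \<le> C \<and> mat_maxnorm L \<le> C \<and>
         dist_rank_ge L c \<and> dist_degen_ge (int_to_real_mat Xi) L c
         \<longrightarrow>
         CARD('d) - 2 \<le> CARD('d) - 2 \<and>
         (\<forall>(\<sigma>F::real) (\<sigma>G::real) (F::real^'h \<Rightarrow> real) (G::real^'m \<Rightarrow> real)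
             (r::'d \<Rightarrow> int) (f::'d \<Rightarrow> int \<Rightarrow> real) (\<rho>::real).
           0 < \<sigma>F \<and> \<sigma>F < 1/2 \<and> 0 < \<sigma>G \<and> \<sigma>G < 1/2 \<and>
           (\<forall>x. 0 \<le> F x \<and> F x \<le> 1) \<and>
           (\<forall>x. F x \<noteq> 0 \<longrightarrow> (\<forall>i. \<bar>x $ i\<bar> \<le> real N)) \<and>
           (\<forall>x y. \<bar>F x - F y\<bar> \<le> AF / (\<sigma>F * real N) * vec_maxnorm (x - y)) \<and>
           (\<forall>x. 0 \<le> G x \<and> G x \<le> 1) \<and>
           (\<forall>x. G x \<noteq> 0 \<longrightarrow> (\<forall>i. \<bar>x $ i\<bar> \<le> \<epsilon>)) \<and>
           (\<forall>x y. \<bar>G x - G y\<bar> \<le> AG / \<sigma>G * vec_maxnorm (x - y)) \<and>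
           (\<forall>j. \<bar>real_of_int (r j)\<bar> \<le> Ar) \<and>
           (\<forall>j x. - 1 \<le> f j x \<and> f j x \<le> 1) \<and>
           (\<forall>j x. x \<notin> {1..int N} \<longrightarrow> f j x = 0) \<and>
           0 < \<rho> \<and> \<rho> \<le> 1 \<and>
           Min (range (\<lambda>j. gowers_interval (CARD('d) - 2 + 1) N (f j))) \<le> \<rho>
           \<longrightarrow>
           \<bar>T_op L Xi r F G N f\<bar> \<le>
             K * (\<rho> powr a * (\<sigma>F powr (- 1) + \<sigma>G powr (- 1))
                  + \<sigma>F powr (- 1) * real N powr (- 1)))"
    if c: "c > 0" and C: "C > 0" and eps: "\<epsilon> > 0" for c C \<epsilon> AF AG Ar :: real
  proof (rule T_op_le_gowers[OF c C eps k(3) k(1,2), where ?AF = AF and ?AG = AG], goal_cases)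
    case (1 K)
    note K = this
    show ?case
    proof (intro exI[of _ K] allI impI conjI, goal_cases)
      case (2 N Xi L \<sigma>F \<sigma>G F G r f \<rho>)
      note geo = 2(1) and an = 2(2)
      have \<sigma>: "0 < \<sigma>F" "\<sigma>F < 1 / 2" "0 < \<sigma>G" using an by blast+
      have powr: "\<sigma>F powr (- 1) = 1 / \<sigma>F" "\<sigma>G powr (- 1) = 1 / \<sigma>G"
        using \<sigma> by (simp_all add: powr_neg_one)
      have nonneg: "0 \<le> \<rho> powr a * (1 / \<sigma>F + 1 / \<sigma>G)" "0 \<le> 1 / \<sigma>F * real N powr (- 1)"
        using \<sigma> by auto
      show ?case
      proof (cases "N = 0")
        \<comment> \<open>\<open>T_op_le_gowers\<close> asks for \<open>N > 0\<close>; for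
          \<open>N = 0\<close> the functions live on an empty interval and the count
          vanishes.\<close>
        case True
        then have "f j x = 0" for j x using an by (metis atLeastAtMost_iff not_one_le_zero of_nat_0 order.trans)
        then have "T_op L Xi r F G N f = 0" by (simp add: T_op_def power_0_left)
        then show ?thesis unfolding powr using nonneg K(1) by simp
      next
        case False
        \<comment> \<open>The minimum is attained, which selects \<open>j0\<close>.\<close>
        have "Min (range (\<lambda>j. gowers_interval k N (f j))) \<in> range (\<lambda>j. gowers_interval k N (f j))"
          by (intro Min_in) auto
        then obtain j0 where j0: "gowers_interval k N (f j0) \<le> \<rho>"
          using an unfolding Sk by (elim conjE imageE) simp
        have F: "0 \<le> F x \<and> F x \<le> 1" "F x \<noteq> 0 \<Longrightarrow> \<forall>i. \<bar>x $ i\<bar> \<le> real N"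
            "\<bar>F x - F y\<bar> \<le> AF / (\<sigma>F * real N) * vec_maxnorm (x - y)" for x y
          using an by blast+
        have G: "0 \<le> G x \<and> G x \<le> 1" "G x \<noteq> 0 \<Longrightarrow> \<forall>i. \<bar>x $ i\<bar> \<le> \<epsilon>"
            "\<bar>G x - G y\<bar> \<le> AG / \<sigma>G * vec_maxnorm (x - y)" for x y
          using an by blast+
        have f: "- 1 \<le> f j x \<and> f j x \<le> 1" "x \<notin> {1..int N} \<Longrightarrow> f j x = 0" for j x
          using an by blast+
        then have f1: "\<bar>f j x\<bar> \<le> 1" for j x by (metis abs_le_iff minus_le_iff)
        have \<rho>: "0 < \<rho>" "\<rho> \<le> 1" using an by blast+
        have geo': "mat_maxnorm (int_to_real_mat Xi) \<le> C" "mat_maxnorm L \<le> C"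
            "dist_rank_ge L c" "dist_degen_ge (int_to_real_mat Xi) L c"
          using geo by blast+
        have "N > 0" "\<sigma>F \<le> 1" using False \<sigma> by auto
        then have "\<bar>T_op L Xi r F G N f\<bar> \<le> K * (\<rho> powr a * (1 / \<sigma>F + 1 / \<sigma>G))"
          unfolding a_def by (intro K(2)[where f = f and ?j0.0 = j0] geo' \<sigma> F G f1 f(2) \<rho> j0)
        also have "\<dots> \<le> K * (\<rho> powr a * (1 / \<sigma>F + 1 / \<sigma>G) + 1 / \<sigma>F * real N powr (- 1))"
          using nonneg K(1) by (intro mult_left_mono) auto
        finally show ?thesis unfolding powr .
      qed
    qed simp
  qed
  \<comment> \<open>The exponents are \<open>a1 = a\<close> and \<open>a2 = b1 = b2 = 1\<close>; the
    constant choice of \<open>S\<close> is independent of \<epsilon>.\<close>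
  show ?thesis
    by (rule exI[of _ a], rule exI[of _ 1], rule exI[of _ 1], rule exI[of _ 1], intro conjI allI impI a0 zero_less_one,
        rule exI[of _ "\<lambda>_ _. CARD('d) - 2"], intro allI impI, rule main)
qed

end
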